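(* Let $X$ be a finite connected symmetric digraph with all $d_v\ge1$ and a voltage assignment $\alpha:E(X)\to\Gamma\simeq\mathbb Z_p^d$. Let $\mathcal O$ be the valuation ring of a finite extension of $\mathbb Q_p$, and put $\Lambda_{\mathcal O,d}=\mathcal O[[T_1,\dots,T_d]]$. Assume that $P(A)\in\mathcal O[A]$ is monic and that $\mathcal F_X(A,T)\in\Lambda_{\mathcal O,d}[A]$. Let $N_{X,P}=\Lambda_{\mathcal O,d}[A]/(P(A))$. Multiplication by $\mathcal F_X(A,T)$ defines a $\Lambda_{\mathcal O,d}$-linear endomorphism $m_{\mathcal F_X}:N_{X,P}\to N_{X,P}$. Set $M_{X,P}=\operatorname{coker}(m_{\mathcal F_X})$. Then \[ \operatorname{Fitt}_0^{\Lambda_{\mathcal O,d}}(M_{X,P})=(\mathcal R_{X,P}(T)). \] In particular, if $\mathcal R_{X,P}(T)\neq0$, then $M_{X,P}$ is a finitely generated torsion $\Lambda_{\mathcal O,d}$-module.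
   Context: Let $p$ be a prime and $d\ge1$. A finite symmetric digraph $X$ has a finite vertex set $V(X)=\{v_1,\dots,v_m\}$ and a finite set $E(X)$ of directed edges (loops and multiple edges allowed) with origin $o(e)$, terminus $t(e)$ and an inversion $e\mapsto\bar e\ne e$ with $\bar{\bar e}=e$, $o(\bar e)=t(e)$. Put $d_v=\#\{e:o(e)=v\}$ and $w(e)=2/d_{o(e)}$ (Grover weight). A voltage assignment satisfies $\alpha(\bar e)=-\alpha(e)$. For $\gamma\in\Gamma\simeq\mathbb Z_p^d$ put $\tau(\gamma)=\prod_i(1+T_i)^{\gamma_i}\in\mathbb Z_p[[T_1,\dots,T_d]]$ ($p$-adic binomial series). Let $W_{\tau,\alpha}$ be the $m\times m$ matrix with $(i,j)$ entry $\sum_{e:v_i\to v_j}w(e)\tau(\alpha(e))$ and $\mathcal F_X(A,T)=\det\bigl((A^2+1)I_m-AW_{\tau,\alpha}\bigr)$, which has coefficients in $\mathbb Q_p[[T_1,\dots,T_d]]$ and is monic of degree $2m$ in $A$. Resultants: for monic $f=\prod_i(A-\alpha_i)$ over an algebraically closed field, $\operatorname{Res}_A(f,g)=\prod_ig(\alpha_i)$. Put $\mathcal R_{X,P}(T)=\operatorname{Res}_A(\mathcal F_X(A,T),P(A))$. $\operatorname{Fitt}_0$ denotes the zeroth Fitting ideal. *)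

theory Defs
  imports
    "HOL-Algebra.Module"
    "HOL-Algebra.QuotRing"
    "HOL-Algebra.Algebraic_Closure_Type"
    "HOL-Computational_Algebra.Computational_Algebra"
    "Jordan_Normal_Form.Determinant"
    "Berlekamp_Zassenhaus.Finite_Field"
    "Graph_Theory.Graph_Theory"
begin

hide_const (open) Divisibility.prime

section \<open>The ring of p-adic integers and its fraction field\<close>

text \<open>
  The prime is carried by a type: p is the cardinality of the type argument, which is
  prime by the class constraint. An element of the ring is a compatible sequence of
  residues: its n-th entry is the reduction modulo the n-th power of p.
\<close>

typedef (overloaded) ('p::prime_card) padic_int =
  "{x :: nat \<Rightarrow> int. \<forall>n. 0 \<le> x n \<and> x n < int CARD('p) ^ n \<and> x (Suc n) mod int CARD('p) ^ n = x n}"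
  morphisms residue Abs_padic_int
  by (rule exI[of _ "\<lambda>_. 0"]) (use prime_card_int[where 'a = 'p] prime_gt_0_int in auto)

setup_lifting type_definition_padic_int

lemma padic_compatI:
  assumes "\<And>n. z (Suc n) mod int CARD('p::prime_card) ^ n = z n mod int CARD('p) ^ n"
  shows "0 \<le> z n mod int CARD('p) ^ n \<and> z n mod int CARD('p) ^ n < int CARD('p) ^ n \<and>
    (z (Suc n) mod int CARD('p) ^ Suc n) mod int CARD('p) ^ n = z n mod int CARD('p) ^ n"
proof -
  have "int CARD('p) > 0"
    using prime_card_int[where 'a = 'p] prime_gt_0_int by blast
  then show ?thesis
    using assms by (simp add: mod_mod_cancel)
qed

lemma padic_compatD:
  assumes "\<And>n. 0 \<le> x n \<and> x n < q ^ n \<and> x (Suc n) mod q ^ n = x n"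
  shows "x (Suc n) mod (q :: int) ^ n = x n mod q ^ n"
  using assms[of n] by (simp add: mod_pos_pos_trivial)

lemma residue_Suc_mod:
  "residue (x :: 'p::prime_card padic_int) (Suc n) mod int CARD('p) ^ n = residue x n"
  using residue[of x] by simp

lemma residue_mod [simp]:
  "residue (x :: 'p::prime_card padic_int) n mod int CARD('p) ^ n = residue x n"
  using residue[of x] by simp

instantiation padic_int :: (prime_card) comm_ring_1
begin

lift_definition zero_padic_int :: "'a padic_int" is "\<lambda>n. 0 mod int CARD('a) ^ n"
  by (intro allI padic_compatI) simp

lift_definition one_padic_int :: "'a padic_int" is "\<lambda>n. 1 mod int CARD('a) ^ n"
  by (intro allI padic_compatI) simp

lift_definition plus_padic_int :: "'a padic_int \<Rightarrow> 'a padic_int \<Rightarrow> 'a padic_int"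
  is "\<lambda>x y n. (x n + y n) mod int CARD('a) ^ n"
  by (intro allI padic_compatI, rule mod_add_cong) (rule padic_compatD, assumption)+

lift_definition minus_padic_int :: "'a padic_int \<Rightarrow> 'a padic_int \<Rightarrow> 'a padic_int"
  is "\<lambda>x y n. (x n - y n) mod int CARD('a) ^ n"
  by (intro allI padic_compatI, rule mod_diff_cong) (rule padic_compatD, assumption)+

lift_definition uminus_padic_int :: "'a padic_int \<Rightarrow> 'a padic_int"
  is "\<lambda>x n. (- x n) mod int CARD('a) ^ n"
  by (intro allI padic_compatI, rule mod_minus_cong) (rule padic_compatD, assumption)+

lift_definition times_padic_int :: "'a padic_int \<Rightarrow> 'a padic_int \<Rightarrow> 'a padic_int"
  is "\<lambda>x y n. (x n * y n) mod int CARD('a) ^ n"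
  by (intro allI padic_compatI, rule mod_mult_cong) (rule padic_compatD, assumption)+

instance
proof
  fix a b c :: "'a padic_int"
  show "a * b * c = a * (b * c)"
    by transfer (auto simp: fun_eq_iff mod_simps mult.assoc)
  show "a * b = b * a"
    by transfer (auto simp: mult.commute)
  show "1 * a = a"
    by transfer (auto simp: fun_eq_iff mod_simps)
  show "a + b + c = a + (b + c)"
    by transfer (auto simp: fun_eq_iff mod_simps add.assoc)
  show "a + b = b + a"
    by transfer (auto simp: add.commute)
  show "0 + a = a"
    by transfer (auto simp: fun_eq_iff)
  show "- a + a = 0"
    by transfer (auto simp: fun_eq_iff mod_simps)
  show "a - b = a + - b"
    by transfer (auto simp: fun_eq_iff mod_simps)
  show "(a + b) * c = a * c + b * c"
    by transfer (auto simp: fun_eq_iff mod_simps distrib_right)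
  show "(0 :: 'a padic_int) \<noteq> 1"
  proof
    assume "(0 :: 'a padic_int) = 1"
    then have "residue (0 :: 'a padic_int) 1 = residue (1 :: 'a padic_int) 1"
      by simp
    then show False
      using prime_card_int[where 'a = 'a] prime_gt_1_int[of "int CARD('a)"]
      by (simp add: zero_padic_int.rep_eq one_padic_int.rep_eq)
  qed
qed

end

lemma residue_mod_le:
  fixes x :: "'p::prime_card padic_int"
  shows "residue x (n + k) mod int CARD('p) ^ n = residue x n"
proof (induction k)
  case (Suc k)
  have "residue x (n + Suc k) mod int CARD('p) ^ n
      = residue x (Suc (n + k)) mod int CARD('p) ^ (n + k) mod int CARD('p) ^ n"
    by (simp add: mod_mod_cancel le_imp_power_dvd)
  then show ?case
    using Suc by (simp add: residue_Suc_mod)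
qed simp

lemma residue_eq_0_iff:
  fixes x :: "'p::prime_card padic_int"
  shows "residue x n = 0 \<longleftrightarrow> int CARD('p) ^ n dvd residue x (n + k)"
  using residue_mod_le[of x n k] by (simp add: dvd_eq_mod_eq_0)

lemma padic_int_eq_0_iff: "x = 0 \<longleftrightarrow> (\<forall>n. residue x n = 0)"
  by (auto simp: residue_inject[symmetric] zero_padic_int.rep_eq fun_eq_iff)

instance padic_int :: (prime_card) idom
proof
  fix x y :: "'a padic_int"
  assume "x \<noteq> 0" "y \<noteq> 0"
  define p where "p = int CARD('a)"
  have p: "prime p"
    unfolding p_def by (rule prime_card_int)
  obtain m n where mn: "residue x m \<noteq> 0" "residue y n \<noteq> 0"
    using \<open>x \<noteq> 0\<close> \<open>y \<noteq> 0\<close> by (auto simp: padic_int_eq_0_iff)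
  have x: "\<not> p ^ m dvd residue x (m + n)" and y: "\<not> p ^ n dvd residue y (m + n)"
    using mn residue_eq_0_iff[of x m n] residue_eq_0_iff[of y n m]
    by (simp_all add: p_def add.commute)
  have nz: "residue x (m + n) \<noteq> 0" "residue y (m + n) \<noteq> 0"
    using x y by auto
  have "multiplicity p (residue x (m + n)) < m" "multiplicity p (residue y (m + n)) < n"
    using x y nz p by (auto simp: power_dvd_iff_le_multiplicity not_le)
  moreover have "multiplicity p (residue x (m + n) * residue y (m + n))
      = multiplicity p (residue x (m + n)) + multiplicity p (residue y (m + n))"
    using nz p by (intro prime_elem_multiplicity_mult_distrib) auto
  ultimately have "\<not> p ^ (m + n) dvd residue x (m + n) * residue y (m + n)"
    using nz p by (subst power_dvd_iff_le_multiplicity) auto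
  then have "residue (x * y) (m + n) \<noteq> 0"
    by (simp add: times_padic_int.rep_eq p_def dvd_eq_mod_eq_0)
  then show "x * y \<noteq> 0"
    by (auto simp: padic_int_eq_0_iff)
qed

lemma residue_of_nat:
  "residue (of_nat k :: 'p::prime_card padic_int) n = int k mod int CARD('p) ^ n"
  by (induction k)
    (simp_all add: zero_padic_int.rep_eq one_padic_int.rep_eq plus_padic_int.rep_eq mod_simps)

instance padic_int :: (prime_card) ring_char_0
proof
  show "inj (of_nat :: nat \<Rightarrow> 'a padic_int)"
  proof (rule injI)
    fix a b :: nat
    assume eq: "(of_nat a :: 'a padic_int) = of_nat b"
    define p where "p = CARD('a)"
    have "p > 1"
      unfolding p_def by (rule prime_gt_1_nat) (rule prime_card)
    have "a + b < p ^ (a + b)"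
      using \<open>p > 1\<close> by (intro power_gt_expt) simp
    then have "int a < int p ^ (a + b)" "int b < int p ^ (a + b)"
      by (simp_all flip: of_nat_power)
    moreover have "int a mod int p ^ (a + b) = int b mod int p ^ (a + b)"
      using arg_cong[OF eq, of "\<lambda>x. residue x (a + b)"] by (simp add: residue_of_nat p_def)
    ultimately show "a = b"
      by simp
  qed
qed

instance fract :: ("{idom, ring_char_0}") field_char_0
proof
  have "(of_nat n :: 'a fract) = to_fract (of_nat n)" for n
    by (induction n) auto
  then show "inj (of_nat :: nat \<Rightarrow> 'a fract)"
    by (auto intro: injI)
qed

type_synonym 'p padic = "'p padic_int fract"

text \<open>
  For nonzero x the number below is the p-adic valuation of x: the largest n such that
  the reduction of x modulo the n-th power of p vanishes.
\<close>

definition padic_abs :: "'p::prime_card padic_int \<Rightarrow> real" where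
  "padic_abs x = (if x = 0 then 0
     else 1 / real CARD('p) ^ (LEAST n. residue x (Suc n) \<noteq> 0))"

definition finite_padic_extension :: "('p::prime_card padic \<Rightarrow> 'k::field) \<Rightarrow> bool" where
  "finite_padic_extension \<iota> \<longleftrightarrow>
     \<iota> 1 = 1 \<and> (\<forall>x y. \<iota> (x + y) = \<iota> x + \<iota> y) \<and> (\<forall>x y. \<iota> (x * y) = \<iota> x * \<iota> y) \<and>
     (\<exists>B. finite_dimensional_vector_space (\<lambda>c x. \<iota> c * x) B)"

text \<open>
  An absolute value that agrees with the p-adic one on the p-adic integers extends, by
  multiplicativity, the p-adic absolute value of the whole fraction field. Such an
  extension is unique, so this determines the valuation ring.
\<close>

definition padic_abs_extension :: "('p::prime_card padic \<Rightarrow> 'k::field) \<Rightarrow> ('k \<Rightarrow> real) \<Rightarrow> bool" where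
  "padic_abs_extension \<iota> v \<longleftrightarrow>
     (\<forall>x. 0 \<le> v x) \<and> (\<forall>x. v x = 0 \<longleftrightarrow> x = 0) \<and> (\<forall>x y. v (x * y) = v x * v y) \<and>
     (\<forall>x y. v (x + y) \<le> max (v x) (v y)) \<and> (\<forall>a. v (\<iota> (to_fract a)) = padic_abs a)"

definition is_valuation_ring :: "('p::prime_card padic \<Rightarrow> 'k::field) \<Rightarrow> 'k set \<Rightarrow> bool" where
  "is_valuation_ring \<iota> R \<longleftrightarrow> (\<exists>v. padic_abs_extension \<iota> v \<and> R = {x. v x \<le> 1})"

section \<open>Formal power series in finitely many variables\<close>

text \<open>
  The variables are indexed by the finite type 'n, so their number d is its cardinality;
  an exponent is a function from 'n to the natural numbers.
\<close>

typedef ('n, 'a) mfps = "UNIV :: (('n \<Rightarrow> nat) \<Rightarrow> 'a) set"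
  morphisms mfps_nth Abs_mfps ..

setup_lifting type_definition_mfps

lemma mfps_eqI: "(\<And>e. mfps_nth f e = mfps_nth g e) \<Longrightarrow> f = g"
  by (simp add: mfps_nth_inject[symmetric] fun_eq_iff)

lemma finite_atMost_exponent: "finite {..e :: 'n::finite \<Rightarrow> nat}"
proof -
  have "{..e} = PiE UNIV (\<lambda>i. {..e i})"
    by (auto simp: le_fun_def PiE_def Pi_def)
  then show ?thesis
    by (simp add: finite_PiE)
qed

instantiation mfps :: (finite, comm_ring_1) comm_ring_1
begin

lift_definition zero_mfps :: "('a, 'b) mfps" is "\<lambda>_. 0" .

lift_definition one_mfps :: "('a, 'b) mfps" is "\<lambda>e. if e = (\<lambda>_. 0) then 1 else 0" .

lift_definition plus_mfps :: "('a, 'b) mfps \<Rightarrow> ('a, 'b) mfps \<Rightarrow> ('a, 'b) mfps"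
  is "\<lambda>f g e. f e + g e" .

lift_definition minus_mfps :: "('a, 'b) mfps \<Rightarrow> ('a, 'b) mfps \<Rightarrow> ('a, 'b) mfps"
  is "\<lambda>f g e. f e - g e" .

lift_definition uminus_mfps :: "('a, 'b) mfps \<Rightarrow> ('a, 'b) mfps"
  is "\<lambda>f e. - f e" .

text \<open>In the product, \<open>{..e}\<close> is taken in the pointwise order on exponents.\<close>

lift_definition times_mfps :: "('a, 'b) mfps \<Rightarrow> ('a, 'b) mfps \<Rightarrow> ('a, 'b) mfps"
  is "\<lambda>f g e. \<Sum>a\<in>{..e}. f a * g (\<lambda>i. e i - a i)" .

instance
proof
  fix f g h :: "('a, 'b) mfps"
  show "f * g = g * f"
  proof (rule mfps_eqI)
    fix e :: "'a \<Rightarrow> nat"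
    show "mfps_nth (f * g) e = mfps_nth (g * f) e"
      unfolding times_mfps.rep_eq
      by (rule sum.reindex_bij_witness[of _ "\<lambda>a i. e i - a i" "\<lambda>a i. e i - a i"])
        (auto simp: le_fun_def fun_eq_iff mult.commute)
  qed
  show "f * g * h = f * (g * h)"
  proof (rule mfps_eqI)
    fix e :: "'a \<Rightarrow> nat"
    have "mfps_nth (f * g * h) e =
      (\<Sum>(a, b)\<in>(SIGMA a:{..e}. {..a}).
        mfps_nth f b * mfps_nth g (\<lambda>i. a i - b i) * mfps_nth h (\<lambda>i. e i - a i))"
      unfolding times_mfps.rep_eq
      by (simp add: sum_distrib_right sum.Sigma finite_atMost_exponent)
    also have "\<dots> = (\<Sum>(b, c)\<in>(SIGMA b:{..e}. {..\<lambda>i. e i - b i}).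
        mfps_nth f b * (mfps_nth g c * mfps_nth h (\<lambda>i. e i - b i - c i)))"
      by (rule sum.reindex_bij_witness[of _ "\<lambda>(b, c). (\<lambda>i. b i + c i, b)" "\<lambda>(a, b). (b, \<lambda>i. a i - b i)"])
        (auto simp: le_fun_def fun_eq_iff mult.assoc le_diff_conv2 add.commute diff_le_mono
          intro: order_trans)
    also have "\<dots> = mfps_nth (f * (g * h)) e"
      unfolding times_mfps.rep_eq
      by (simp add: sum_distrib_left sum.Sigma finite_atMost_exponent)
    finally show "mfps_nth (f * g * h) e = mfps_nth (f * (g * h)) e" .
  qed
  show "1 * f = f"
  proof (rule mfps_eqI)
    fix e :: "'a \<Rightarrow> nat"
    have "mfps_nth (1 * f) e = (\<Sum>a\<in>{..e}. if a = (\<lambda>_. 0) then mfps_nth f e else 0)"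
      unfolding times_mfps.rep_eq one_mfps.rep_eq by (intro sum.cong) auto
    then show "mfps_nth (1 * f) e = mfps_nth f e"
      by (simp add: finite_atMost_exponent le_fun_def)
  qed
  show "(f + g) * h = f * h + g * h"
    by (rule mfps_eqI) (simp add: times_mfps.rep_eq plus_mfps.rep_eq distrib_right sum.distrib)
  show "f + g + h = f + (g + h)" "f + g = g + f" "0 + f = f" "- f + f = 0" "f - g = f + - g"
    by (transfer; simp add: fun_eq_iff algebra_simps)+
  show "(0 :: ('a, 'b) mfps) \<noteq> 1"
    by transfer (auto simp: fun_eq_iff)
qed

end

lemma ex_lex_least_exponent:
  fixes S :: "('n::finite \<Rightarrow> nat) set" and h :: "'n \<Rightarrow> nat"
  assumes "inj h" "S \<noteq> {}"
  obtains a where "a \<in> S"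
    "\<And>b. b \<in> S \<Longrightarrow> b \<noteq> a \<Longrightarrow> \<exists>i. a i < b i \<and> (\<forall>j. h j < h i \<longrightarrow> a j = b j)"
proof -
  have step: "\<exists>a\<in>S. \<forall>b\<in>S. (\<forall>j. h j < k \<longrightarrow> a j = b j) \<or>
      (\<exists>i. h i < k \<and> a i < b i \<and> (\<forall>j. h j < h i \<longrightarrow> a j = b j))" for k
  proof (induction k)
    case 0
    then show ?case
      using \<open>S \<noteq> {}\<close> by auto
  next
    case (Suc k)
    then obtain a where a: "a \<in> S"
      "\<And>b. b \<in> S \<Longrightarrow> (\<forall>j. h j < k \<longrightarrow> a j = b j) \<or>
        (\<exists>i. h i < k \<and> a i < b i \<and> (\<forall>j. h j < h i \<longrightarrow> a j = b j))"
      by blast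
    show ?case
    proof (cases "\<exists>i. h i = k")
      case False
      then have "h j < Suc k \<longleftrightarrow> h j < k" for j
        by (auto simp: less_Suc_eq)
      then show ?thesis
        using Suc by simp
    next
      case True
      then obtain i where i: "h i = k" ..
      define T where "T = {b \<in> S. \<forall>j. h j < k \<longrightarrow> a j = b j}"
      have "a \<in> T"
        using a by (auto simp: T_def)
      then obtain c where c: "c \<in> T" "\<And>b. b \<in> T \<Longrightarrow> c i \<le> b i"
        using ex_has_least_nat[of "\<lambda>b. b \<in> T" a "\<lambda>b. b i"] by auto
      have hi: "h j = k \<longleftrightarrow> j = i" for j
        using i \<open>inj h\<close> by (auto dest: injD)
      have "(\<forall>j. h j < Suc k \<longrightarrow> c j = b j) \<or>
        (\<exists>i. h i < Suc k \<and> c i < b i \<and> (\<forall>j. h j < h i \<longrightarrow> c j = b j))" if b: "b \<in> S" for b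
      proof (cases "b \<in> T")
        case True
        then have agree: "\<forall>j. h j < k \<longrightarrow> c j = b j"
          using c(1) by (auto simp: T_def)
        show ?thesis
        proof (cases "c i = b i")
          case True
          then show ?thesis
            using agree hi by (auto simp: less_Suc_eq)
        next
          case False
          then have "c i < b i"
            using c(2)[OF \<open>b \<in> T\<close>] by simp
          then show ?thesis
            using agree i by blast
        qed
      next
        case False
        then obtain l where l: "h l < k" "a l < b l" "\<forall>j. h j < h l \<longrightarrow> a j = b j"
          using a(2)[OF b] b by (auto simp: T_def)
        have "\<forall>j. h j < k \<longrightarrow> a j = c j"
          using c(1) by (auto simp: T_def)
        then have "h l < Suc k \<and> c l < b l \<and> (\<forall>j. h j < h l \<longrightarrow> c j = b j)"
          using l by auto
        then show ?thesis
          by blast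
      qed
      then show ?thesis
        using c(1) by (auto simp: T_def)
    qed
  qed
  have "\<exists>k. \<forall>j. h j < k"
    using finite_nat_set_iff_bounded[of "range h"] by auto
  then obtain k where k: "\<And>j. h j < k"
    by blast
  obtain a where "a \<in> S" and a: "\<And>b. b \<in> S \<Longrightarrow> (\<forall>j. h j < k \<longrightarrow> a j = b j) \<or>
      (\<exists>i. h i < k \<and> a i < b i \<and> (\<forall>j. h j < h i \<longrightarrow> a j = b j))"
    using step[of k] by blast
  show ?thesis
  proof (rule that[OF \<open>a \<in> S\<close>])
    fix b assume "b \<in> S" "b \<noteq> a"
    then show "\<exists>i. a i < b i \<and> (\<forall>j. h j < h i \<longrightarrow> a j = b j)"
      using a[of b] k by (auto simp: fun_eq_iff)
  qed
qed

instance mfps :: (finite, idom) idom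
proof
  fix f g :: "('a, 'b) mfps"
  assume "f \<noteq> 0" "g \<noteq> 0"
  have nz: "\<exists>a. mfps_nth u a \<noteq> 0" if "u \<noteq> 0" for u :: "('a, 'b) mfps"
    using that by (metis mfps_eqI zero_mfps.rep_eq)
  obtain h :: "'a \<Rightarrow> nat" where "inj h"
    using finite_imp_inj_to_nat_seg[of "UNIV :: 'a set"] by auto
  obtain a where a: "mfps_nth f a \<noteq> 0"
    "\<And>c. mfps_nth f c \<noteq> 0 \<Longrightarrow> c \<noteq> a \<Longrightarrow> \<exists>i. a i < c i \<and> (\<forall>j. h j < h i \<longrightarrow> a j = c j)"
    using ex_lex_least_exponent[OF \<open>inj h\<close>, of "{a. mfps_nth f a \<noteq> 0}"] nz[OF \<open>f \<noteq> 0\<close>]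
    by auto
  obtain b where b: "mfps_nth g b \<noteq> 0"
    "\<And>c. mfps_nth g c \<noteq> 0 \<Longrightarrow> c \<noteq> b \<Longrightarrow> \<exists>i. b i < c i \<and> (\<forall>j. h j < h i \<longrightarrow> b j = c j)"
    using ex_lex_least_exponent[OF \<open>inj h\<close>, of "{a. mfps_nth g a \<noteq> 0}"] nz[OF \<open>g \<noteq> 0\<close>]
    by auto
  define e where "e = (\<lambda>i. a i + b i)"
  have "mfps_nth f c * mfps_nth g (\<lambda>i. e i - c i) = 0" if c: "c \<le> e" "c \<noteq> a" for c
  proof (rule ccontr)
    assume nz: "mfps_nth f c * mfps_nth g (\<lambda>i. e i - c i) \<noteq> 0"
    define d where "d = (\<lambda>i. e i - c i)"
    have cd: "c i + d i = a i + b i" for i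
      using c(1) by (auto simp: d_def e_def le_fun_def)
    have "d \<noteq> b"
    proof
      assume "d = b"
      then have "c i = a i" for i
        using cd[of i] by simp
      then show False
        using c(2) by auto
    qed
    obtain i where i: "a i < c i" "\<And>j. h j < h i \<Longrightarrow> a j = c j"
      using a(2)[of c] nz c(2) by auto
    obtain l where l: "b l < d l" "\<And>j. h j < h l \<Longrightarrow> b j = d j"
      using b(2)[of d] nz \<open>d \<noteq> b\<close> by (auto simp: d_def)
    consider "h i < h l" | "h l < h i" | "i = l"
      using \<open>inj h\<close> by (metis injD linorder_neqE_nat)
    then show False
    proof cases
      case 1
      then show ?thesis using i l(2)[of i] cd[of i] by simp
    next
      case 2
      then show ?thesis using l i(2)[of l] cd[of l] by simp
    next
      case 3
      then show ?thesis using i l cd[of i] by simp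
    qed
  qed
  then have "mfps_nth (f * g) e = (\<Sum>c\<in>{a}. mfps_nth f c * mfps_nth g (\<lambda>i. e i - c i))"
    unfolding times_mfps.rep_eq
    by (intro sum.mono_neutral_right finite_atMost_exponent) (auto simp: e_def le_fun_def)
  also have "\<dots> = mfps_nth f a * mfps_nth g b"
    by (simp add: e_def)
  finally have "mfps_nth (f * g) e \<noteq> 0"
    using a b by simp
  then show "f * g \<noteq> 0"
    by (auto simp: zero_mfps.rep_eq)
qed

lift_definition mfps_const :: "'a::zero \<Rightarrow> ('n, 'a) mfps"
  is "\<lambda>c e. if e = (\<lambda>_. 0) then c else 0" .

lift_definition map_mfps :: "('a \<Rightarrow> 'b) \<Rightarrow> ('n, 'a) mfps \<Rightarrow> ('n, 'b) mfps"
  is "\<lambda>h f e. h (f e)" .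

definition mfps_over :: "'a set \<Rightarrow> ('n, 'a) mfps set" where
  "mfps_over S = {f. \<forall>e. mfps_nth f e \<in> S}"

definition poly_over :: "'a::zero set \<Rightarrow> 'a poly set" where
  "poly_over S = {f. \<forall>i. coeff f i \<in> S}"

section \<open>The Grover determinant of a voltage assignment\<close>

text \<open>
  \<open>binomial_mfps i x\<close> is the p-adic binomial series of \<open>(1 + T\<^sub>i)\<^sup>x\<close>. Its coefficients are
  p-adic integers, but are written in the fraction field, where the binomial
  coefficient \<open>x (x - 1) \<dots> (x - k + 1) / k!\<close> can be formed.
\<close>

definition binomial_mfps :: "'n \<Rightarrow> 'p::prime_card padic_int \<Rightarrow> ('n, 'p padic) mfps" where
  "binomial_mfps i x =
     Abs_mfps (\<lambda>e. if \<forall>j. j \<noteq> i \<longrightarrow> e j = 0 then to_fract x gchoose e i else 0)"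

definition voltage_char :: "('n::finite \<Rightarrow> 'p::prime_card padic_int) \<Rightarrow> ('n, 'p padic) mfps" where
  "voltage_char \<gamma> = (\<Prod>i\<in>UNIV. binomial_mfps i (\<gamma> i))"

definition grover_weight :: "('v, 'e) pre_digraph \<Rightarrow> 'e \<Rightarrow> 'p::prime_card padic" where
  "grover_weight G e = 2 / of_nat (out_degree G (tail G e))"

text \<open>The list \<open>vs\<close> is the chosen numbering of the vertices.\<close>

definition voltage_matrix ::
  "('v, 'e) pre_digraph \<Rightarrow> 'v list \<Rightarrow> ('e \<Rightarrow> 'n::finite \<Rightarrow> 'p::prime_card padic_int) \<Rightarrow>
     ('n, 'p padic) mfps mat" where
  "voltage_matrix G vs \<alpha> = mat (length vs) (length vs) (\<lambda>(i, j).
     \<Sum>e\<in>{e \<in> arcs G. tail G e = vs ! i \<and> head G e = vs ! j}.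
       mfps_const (grover_weight G e) * voltage_char (\<alpha> e))"

definition grover_poly ::
  "('v, 'e) pre_digraph \<Rightarrow> 'v list \<Rightarrow> ('e \<Rightarrow> 'n::finite \<Rightarrow> 'p::prime_card padic_int) \<Rightarrow>
     ('n, 'p padic) mfps poly" where
  "grover_poly G vs \<alpha> = Determinant.det
     (([:0, 1:] ^ 2 + 1) \<cdot>\<^sub>m 1\<^sub>m (length vs) -
      [:0, 1:] \<cdot>\<^sub>m map_mat (\<lambda>c. [:c:]) (voltage_matrix G vs \<alpha>))"

section \<open>Resultants, quotient modules and Fitting ideals\<close>

text \<open>
  The product of the values of g at the roots of the monic polynomial f, taken in an
  algebraic closure of the fraction field and read back in the base ring, in which it lies.
\<close>

definition monic_resultant :: "'a::idom poly \<Rightarrow> 'a poly \<Rightarrow> 'a" where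
  "monic_resultant f g = (THE r. to_ac (to_fract r) =
     (\<Prod>\<xi>\<in>#proots (map_poly (\<lambda>c. to_ac (to_fract c)) f).
        poly (map_poly (\<lambda>c. to_ac (to_fract c)) g) \<xi>))"

definition subset_ring :: "'a::comm_ring_1 set \<Rightarrow> 'a ring" where
  "subset_ring S = \<lparr>carrier = S, monoid.mult = (*), one = 1, ring.zero = 0, add = (+)\<rparr>"

text \<open>
  The residue class of f in \<open>S[A]/(P)\<close> and this quotient ring as an S-module, for a
  subring S of the type.
\<close>

definition poly_ideal :: "'a::comm_ring_1 set \<Rightarrow> 'a poly \<Rightarrow> 'a poly set" where
  "poly_ideal S P = PIdl\<^bsub>subset_ring (poly_over S)\<^esub> P"

definition poly_class :: "'a::comm_ring_1 set \<Rightarrow> 'a poly \<Rightarrow> 'a poly \<Rightarrow> 'a poly set" where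
  "poly_class S P f = poly_ideal S P +>\<^bsub>subset_ring (poly_over S)\<^esub> f"

definition poly_quot :: "'a::comm_ring_1 set \<Rightarrow> 'a poly \<Rightarrow> ('a, 'a poly set) module" where
  "poly_quot S P = (let Q = subset_ring (poly_over S) Quot poly_ideal S P in
     \<lparr>carrier = carrier Q, monoid.mult = monoid.mult Q, one = one Q, ring.zero = ring.zero Q, add = add Q,
      module.smult = (\<lambda>a x. poly_class S P [:a:] \<otimes>\<^bsub>Q\<^esub> x)\<rparr>)"

definition mult_map :: "'a::comm_ring_1 set \<Rightarrow> 'a poly \<Rightarrow> 'a poly \<Rightarrow> 'a poly set \<Rightarrow> 'a poly set" where
  "mult_map S P f = (\<lambda>x. poly_class S P f \<otimes>\<^bsub>poly_quot S P\<^esub> x)"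

definition linear_maps ::
  "('a, 'm) ring_scheme \<Rightarrow> ('a, 'b, 'm1) module_scheme \<Rightarrow> ('a, 'c, 'm2) module_scheme \<Rightarrow> ('b \<Rightarrow> 'c) set"
  where "linear_maps R M N = {f \<in> carrier M \<rightarrow> carrier N.
     (\<forall>x\<in>carrier M. \<forall>y\<in>carrier M. f (x \<oplus>\<^bsub>M\<^esub> y) = f x \<oplus>\<^bsub>N\<^esub> f y) \<and>
     (\<forall>a\<in>carrier R. \<forall>x\<in>carrier M. f (a \<odot>\<^bsub>M\<^esub> x) = a \<odot>\<^bsub>N\<^esub> f x)}"

text \<open>The multiplicative part of the record is irrelevant for a module and left unspecified.\<close>

definition quot_module :: "('a, 'b, 'm) module_scheme \<Rightarrow> 'b set \<Rightarrow> ('a, 'b set) module" where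
  "quot_module M H = \<lparr>carrier = a_rcosets\<^bsub>M\<^esub> H, monoid.mult = undefined, one = undefined,
     ring.zero = H, add = set_add M, module.smult = (\<lambda>a C. \<Union>x\<in>C. H +>\<^bsub>M\<^esub> (a \<odot>\<^bsub>M\<^esub> x))\<rparr>"

definition coker :: "('a, 'b, 'm) module_scheme \<Rightarrow> ('c, 'd, 'l) module_scheme \<Rightarrow> ('b \<Rightarrow> 'd) \<Rightarrow>
    ('c, 'd set) module" where
  "coker M N f = quot_module N (f ` carrier M)"

definition generates ::
  "('a, 'r) ring_scheme \<Rightarrow> ('a, 'b, 'm) module_scheme \<Rightarrow> nat \<Rightarrow> (nat \<Rightarrow> 'b) \<Rightarrow> bool" where
  "generates R M n x \<longleftrightarrow> x \<in> {..<n} \<rightarrow> carrier M \<and>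
     (\<forall>y\<in>carrier M. \<exists>a\<in>{..<n} \<rightarrow> carrier R. y = (\<Oplus>\<^bsub>M\<^esub>i\<in>{..<n}. a i \<odot>\<^bsub>M\<^esub> x i))"

definition finitely_generated :: "('a, 'r) ring_scheme \<Rightarrow> ('a, 'b, 'm) module_scheme \<Rightarrow> bool" where
  "finitely_generated R M \<longleftrightarrow> (\<exists>n x. generates R M n x)"

definition torsion_module :: "('a, 'r) ring_scheme \<Rightarrow> ('a, 'b, 'm) module_scheme \<Rightarrow> bool" where
  "torsion_module R M \<longleftrightarrow>
     (\<forall>y\<in>carrier M. \<exists>a\<in>carrier R. a \<noteq> \<zero>\<^bsub>R\<^esub> \<and> a \<odot>\<^bsub>M\<^esub> y = \<zero>\<^bsub>M\<^esub>)"

text \<open>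
  The relation matrices of size n among the generators \<open>x 0, \<dots>, x (n - 1)\<close> of an S-module:
  each row is a relation. Their determinants are the maximal minors of the
  presentation matrix in which all relations occur. The zeroth Fitting ideal is the ideal
  they generate; by Fitting's lemma it does not depend on the generators, so that an
  arbitrary finite generating family may be chosen.
\<close>

definition relation_matrices ::
  "'a::comm_ring_1 set \<Rightarrow> ('a, 'b, 'm) module_scheme \<Rightarrow> nat \<Rightarrow> (nat \<Rightarrow> 'b) \<Rightarrow> 'a mat set" where
  "relation_matrices S M n x = {B \<in> carrier_mat n n.
     (\<forall>i<n. \<forall>j<n. B $$ (i, j) \<in> S) \<and>
     (\<forall>i<n. (\<Oplus>\<^bsub>M\<^esub>j\<in>{..<n}. B $$ (i, j) \<odot>\<^bsub>M\<^esub> x j) = \<zero>\<^bsub>M\<^esub>)}"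

definition fitting0 :: "'a::comm_ring_1 set \<Rightarrow> ('a, 'b, 'm) module_scheme \<Rightarrow> 'a set" where
  "fitting0 S M = (let (n, x) = (SOME (n, x). generates (subset_ring S) M n x) in
     Idl\<^bsub>subset_ring S\<^esub> (Determinant.det ` relation_matrices S M n x))"

end

theory Submission
  imports Defs
begin

text \<open>
  Let C be the matrix whose rows are the coordinates, in the basis of powers of the variable, of
  \<open>A\<^sup>i F\<close> modulo P. The relations among the classes of the powers in the cokernel are exactly the
  combinations of the rows of C, so the Fitting ideal computed from these generators is generated by
  \<open>det C\<close>; Fitting's lemma allows any other choice of generators, and Cramer's rule shows that
  \<open>det C\<close> kills the cokernel. Over an algebraic closure the monic polynomial F splits, and since
  multiplication matrices are multiplicative in F, it is enough to treat \<open>A - \<xi>\<close>, whose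
  matrix is a shifted companion matrix of determinant \<open>\<plusminus> P(\<xi>)\<close>. Hence \<open>det C\<close> is the resultant
  up to sign. The Grover determinant is monic by its Leibniz expansion.
\<close>

section \<open>Subrings of integral domains\<close>

text \<open>The rings \<open>\<O>\<close>, \<open>\<Lambda>\<close> and their polynomial rings
  appear as subsets \<open>S\<close> of integral domains, because module theory speaks of carriers
  while determinants, divisibility and algebraic closures live on whole types. Two facts bridge the
  gap: division by a monic polynomial never leaves \<open>S\<close>, so \<open>P dvd f\<close> in
  the ambient polynomial ring means membership in the ideal generated by P over \<open>S\<close>;
  and a determinant with entries in \<open>S\<close> lies in \<open>S\<close>. The matrix of
  multiplication by F can therefore be described by divisibility alone. This makes it unique,
  multiplicative in F and compatible with injective homomorphisms, so its determinant may be
  computed where F splits, although the roots may lie outside \<open>S\<close>. F is factored rather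
  than P because the resultant is a product over the roots of F. Since the Fitting ideal is defined
  through an arbitrary choice of generators, independence of that choice is a genuine part of the
  argument. The sign relating determinant and resultant is a unit, hence invisible in the
  ideal.\<close>

lemma subset_ring_simps [simp]:
  "carrier (subset_ring S) = S" "x \<otimes>\<^bsub>subset_ring S\<^esub> y = x * y" "\<one>\<^bsub>subset_ring S\<^esub> = 1"
  "\<zero>\<^bsub>subset_ring S\<^esub> = 0" "x \<oplus>\<^bsub>subset_ring S\<^esub> y = x + y"
  by (simp_all add: subset_ring_def)

locale subring_set =
  fixes S :: "'a::idom set"
  assumes zero_mem [simp]: "0 \<in> S" and one_mem [simp]: "1 \<in> S"
    and add_mem: "x \<in> S \<Longrightarrow> y \<in> S \<Longrightarrow> x + y \<in> S"
    and uminus_mem: "x \<in> S \<Longrightarrow> - x \<in> S"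
    and mult_mem: "x \<in> S \<Longrightarrow> y \<in> S \<Longrightarrow> x * y \<in> S"
begin

lemma diff_mem: "x \<in> S \<Longrightarrow> y \<in> S \<Longrightarrow> x - y \<in> S"
  using add_mem[of x "- y"] uminus_mem by simp

lemma sum_mem: "(\<And>i. i \<in> I \<Longrightarrow> f i \<in> S) \<Longrightarrow> sum f I \<in> S"
  by (induction I rule: infinite_finite_induct) (auto intro: add_mem)

lemma prod_mem: "(\<And>i. i \<in> I \<Longrightarrow> f i \<in> S) \<Longrightarrow> prod f I \<in> S"
  by (induction I rule: infinite_finite_induct) (auto intro: mult_mem)

lemma neg_one_power_mem [simp]: "(- 1) ^ k \<in> S"
  by (induction k) (auto intro: mult_mem uminus_mem)

lemma det_mem:
  assumes "B \<in> carrier_mat n n" "\<And>i j. i < n \<Longrightarrow> j < n \<Longrightarrow> B $$ (i, j) \<in> S"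
  shows "Determinant.det B \<in> S"
  unfolding det_def'[OF assms(1)]
proof (rule sum_mem)
  fix p assume p: "p \<in> {p. p permutes {0..<n}}"
  have "signof p \<in> S"
    by (cases p rule: sign_cases) (auto intro: uminus_mem)
  moreover have "p i < n" if "i < n" for i
    using p that permutes_in_image[of p "{0..<n}" i] by auto
  ultimately show "signof p * (\<Prod>i = 0..<n. B $$ (i, p i)) \<in> S"
    using assms(2) by (auto intro!: mult_mem prod_mem)
qed

lemma cring_subset_ring: "cring (subset_ring S)"
proof (rule cringI)
  show "abelian_group (subset_ring S)"
    by (rule abelian_groupI) (auto simp: add_mem add.assoc add.commute intro: uminus_mem exI[of _ "- _"]
        bexI[where x = "- _"])
  show "Group.comm_monoid (subset_ring S)"
    by (rule comm_monoidI) (auto simp: mult_mem mult.assoc mult.commute)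
qed (auto simp: distrib_right)

lemma PIdl_subset_ring: "PIdl\<^bsub>subset_ring S\<^esub> a = {x * a | x. x \<in> S}"
  by (simp add: cgenideal_def)

lemma sum_mem_ideal:
  assumes "ideal J (subset_ring S)" "\<And>i. i \<in> I \<Longrightarrow> f i \<in> J"
  shows "sum f I \<in> J"
proof -
  interpret J: ideal J "subset_ring S" by fact
  show ?thesis
    using assms(2) additive_subgroup.a_closed[OF J.is_additive_subgroup, simplified]
      additive_subgroup.zero_closed[OF J.is_additive_subgroup, simplified]
    by (induction I rule: infinite_finite_induct) auto
qed

lemma det_mem_ideal_of_minors:
  assumes J: "ideal J (subset_ring S)"
    and K: "K \<in> carrier_mat (m + n) (m + n)"
    and entries: "\<And>i j. i < m + n \<Longrightarrow> j < m + n \<Longrightarrow> K $$ (i, j) \<in> S"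
    and minors: "\<And>f. (\<And>i. i < n \<Longrightarrow> f i < m + n) \<Longrightarrow>
      Determinant.det (mat n n (\<lambda>(i, j). K $$ (f i, m + j))) \<in> J"
  shows "Determinant.det K \<in> J"
  using K entries minors
proof (induction m arbitrary: K)
  case 0
  have "K = mat n n (\<lambda>(i, j). K $$ (id i, 0 + j))"
    using 0 by (intro eq_matI) auto
  then show ?case
    using 0(3)[of id] by simp
next
  case (Suc m)
  interpret J: ideal J "subset_ring S" by fact
  have "K $$ (i, 0) * cofactor K i 0 \<in> J" if i: "i < Suc m + n" for i
  proof -
    let ?D = "mat_delete K i 0"
    have D: "?D \<in> carrier_mat (m + n) (m + n)"
      using mat_delete_carrier[OF Suc.prems(1)] by simp
    have idx: "?D $$ (k, j) = K $$ (if k < i then k else Suc k, Suc j)"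
      if "k < m + n" "j < m + n" for k j
      using that Suc.prems(1) by (simp add: mat_delete_def)
    have "Determinant.det ?D \<in> J"
    proof (rule Suc.IH[OF D])
      show "?D $$ (k, j) \<in> S" if "k < m + n" "j < m + n" for k j
        using that by (auto simp: idx intro!: Suc.prems(2))
      fix f :: "nat \<Rightarrow> nat" assume f: "\<And>k. k < n \<Longrightarrow> f k < m + n"
      have "mat n n (\<lambda>(k, j). ?D $$ (f k, m + j)) =
          mat n n (\<lambda>(k, j). K $$ ((if f k < i then f k else Suc (f k)), Suc m + j))"
        using f by (intro eq_matI) (auto simp: idx)
      then show "Determinant.det (mat n n (\<lambda>(k, j). ?D $$ (f k, m + j))) \<in> J"
        using Suc.prems(3)[of "\<lambda>k. if f k < i then f k else Suc (f k)"] f by fastforce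
    qed
    then show ?thesis
      using J.I_l_closed[of "Determinant.det ?D" "K $$ (i, 0) * (- 1) ^ i"] Suc.prems(2)[OF i, of 0]
      by (simp add: cofactor_def mult.assoc mult_mem)
  qed
  moreover have "Determinant.det K = (\<Sum>i<Suc m + n. K $$ (i, 0) * cofactor K i 0)"
    by (rule laplace_expansion_column[OF Suc.prems(1)]) simp
  ultimately show ?case
    using sum_mem_ideal[OF J, of "{..<Suc m + n}"] by (simp only: lessThan_iff)
qed

end

section \<open>Fitting's lemma\<close>

locale subset_module = subring_set S + Module.module "subset_ring S" M
  for S :: "'a::idom set" and M :: "('a, 'b, 'm) module_scheme" (structure)
begin

text \<open>Associativity (b C) x = b (C x) for a row b, a matrix C and a family x of module
  elements. Through it, matrix identities over \<open>S\<close> become statements about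
  relations.\<close>

lemma finsum_matrix_mult:
  fixes m n :: nat
  assumes "\<And>k. k < m \<Longrightarrow> b k \<in> S" "\<And>k j. k < m \<Longrightarrow> j < n \<Longrightarrow> C k j \<in> S" "x \<in> {..<n} \<rightarrow> carrier M"
  shows "(\<Oplus>j\<in>{..<n}. (\<Sum>k<m. b k * C k j) \<odot> x j) =
    (\<Oplus>k\<in>{..<m}. b k \<odot> (\<Oplus>j\<in>{..<n}. C k j \<odot> x j))"
  using assms(1) assms(2)
proof (induct m)
  case 0
  then show ?case
    using assms(3) smult_l_null[simplified] by (auto intro!: M.add.finprod_one_eqI)
next
  case (Suc m)
  have x: "x j \<in> carrier M" if "j < n" for j
    using that assms(3) by auto
  have C: "C m j \<odot> x j \<in> carrier M" if "j < n" for j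
    using that x Suc(3) by auto
  have s: "(\<Sum>k<m. b k * C k j) \<in> S" if "j < n" for j
    using that Suc(2,3) by (auto intro!: sum_mem mult_mem)
  have "(\<Oplus>j\<in>{..<n}. (\<Sum>k<Suc m. b k * C k j) \<odot> x j) =
      (\<Oplus>j\<in>{..<n}. (\<Sum>k<m. b k * C k j) \<odot> x j \<oplus> b m \<odot> (C m j \<odot> x j))"
    using x s Suc(2,3) smult_l_distr[simplified] smult_assoc1[simplified] C
    by (intro M.finsum_cong') (auto simp: mult_mem)
  also have "\<dots> = (\<Oplus>j\<in>{..<n}. (\<Sum>k<m. b k * C k j) \<odot> x j) \<oplus> (\<Oplus>j\<in>{..<n}. b m \<odot> (C m j \<odot> x j))"
    using x s C Suc(2,3) by (intro M.finsum_addf) auto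
  also have "(\<Oplus>j\<in>{..<n}. b m \<odot> (C m j \<odot> x j)) = b m \<odot> (\<Oplus>j\<in>{..<n}. C m j \<odot> x j)"
    using C Suc(2,3) by (intro finsum_smult_ldistr[symmetric]) auto
  also have "(\<Oplus>j\<in>{..<n}. (\<Sum>k<m. b k * C k j) \<odot> x j) =
      (\<Oplus>k\<in>{..<m}. b k \<odot> (\<Oplus>j\<in>{..<n}. C k j \<odot> x j))"
    using Suc by simp
  also have "\<dots> \<oplus> b m \<odot> (\<Oplus>j\<in>{..<n}. C m j \<odot> x j) =
      (\<Oplus>k\<in>{..<Suc m}. b k \<odot> (\<Oplus>j\<in>{..<n}. C k j \<odot> x j))"
  proof -
    have "b k \<odot> (\<Oplus>j\<in>{..<n}. C k j \<odot> x j) \<in> carrier M" if "k < Suc m" for k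
      using that Suc(2,3) x by (auto intro!: M.finsum_closed)
    then show ?thesis
      unfolding lessThan_Suc by (subst M.finsum_insert) (auto intro!: M.add.m_comm M.finsum_closed)
  qed
  finally show ?case .
qed

lemma finsum_add_coeffs:
  fixes n :: nat
  assumes "\<And>j. j < n \<Longrightarrow> a j \<in> S" "\<And>j. j < n \<Longrightarrow> b j \<in> S" "x \<in> {..<n} \<rightarrow> carrier M"
  shows "(\<Oplus>j\<in>{..<n}. (a j + b j) \<odot> x j) = (\<Oplus>j\<in>{..<n}. a j \<odot> x j) \<oplus> (\<Oplus>j\<in>{..<n}. b j \<odot> x j)"
proof -
  have x: "x j \<in> carrier M" if "j < n" for j
    using that assms(3) by auto
  have "(\<Oplus>j\<in>{..<n}. (a j + b j) \<odot> x j) = (\<Oplus>j\<in>{..<n}. a j \<odot> x j \<oplus> b j \<odot> x j)"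
    using assms x smult_l_distr[simplified] by (intro M.finsum_cong') auto
  then show ?thesis
    using assms x by (simp add: M.finsum_addf Pi_iff)
qed

lemma finsum_unit_vector:
  fixes i n :: nat
  assumes "i < n" "c \<in> S" "x \<in> {..<n} \<rightarrow> carrier M"
  shows "(\<Oplus>j\<in>{..<n}. (if i = j then c else 0) \<odot> x j) = c \<odot> x i"
proof -
  have "(\<Oplus>j\<in>{..<n}. (if i = j then c else 0) \<odot> x j) =
      (\<Oplus>j\<in>{..<n}. if i = j then c \<odot> x j else \<zero>)"
    using assms smult_l_null[simplified] smult_closed[simplified]
    by (intro M.finsum_cong') (auto simp: Pi_iff)
  also have "\<dots> = c \<odot> x i"
    using assms smult_closed[simplified] by (intro M.finsum_singleton) (auto simp: Pi_iff)
  finally show ?thesis .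
qed

lemma generates_matrix:
  assumes "generates (subset_ring S) M n x" "y \<in> {..<m} \<rightarrow> carrier M"
  obtains C where "\<And>k j. k < m \<Longrightarrow> j < n \<Longrightarrow> C k j \<in> S"
    "\<And>k. k < m \<Longrightarrow> y k = (\<Oplus>j\<in>{..<n}. C k j \<odot> x j)"
proof -
  have "\<exists>a. k < m \<longrightarrow> a \<in> {..<n} \<rightarrow> S \<and> y k = (\<Oplus>j\<in>{..<n}. a j \<odot> x j)" for k
    using assms by (cases "k < m") (fastforce simp: generates_def Pi_iff)+
  then obtain C where "\<And>k. k < m \<longrightarrow> C k \<in> {..<n} \<rightarrow> S \<and> y k = (\<Oplus>j\<in>{..<n}. C k j \<odot> x j)"
    by metis
  then show ?thesis
    by (intro that[of C]) auto
qed

text \<open>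
  If y = C x and x = D y, a relation matrix B of y extends by the relations x = D y to a matrix
  of the same determinant; eliminating y from its rows leaves relations of x in the last columns.
\<close>

lemma fitting_ideal_mono:
  assumes x: "generates (subset_ring S) M n x" and y: "generates (subset_ring S) M m y"
  shows "Idl\<^bsub>subset_ring S\<^esub> (Determinant.det ` relation_matrices S M m y) \<subseteq>
    Idl\<^bsub>subset_ring S\<^esub> (Determinant.det ` relation_matrices S M n x)"
proof -
  define J where "J = Idl\<^bsub>subset_ring S\<^esub> (Determinant.det ` relation_matrices S M n x)"
  have sub: "Determinant.det ` relation_matrices S M n x \<subseteq> S"
    by (auto simp: relation_matrices_def intro: det_mem)
  have J: "ideal J (subset_ring S)"
    unfolding J_def using sub by (intro R.genideal_ideal) simp
  have J_mem: "Determinant.det B \<in> J" if "B \<in> relation_matrices S M n x" for B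
    unfolding J_def using R.genideal_self[simplified, OF sub] that by auto
  have xc: "x \<in> {..<n} \<rightarrow> carrier M" and yc: "y \<in> {..<m} \<rightarrow> carrier M"
    using x y by (auto simp: generates_def)
  obtain C where C: "\<And>k j. k < m \<Longrightarrow> j < n \<Longrightarrow> C k j \<in> S"
    "\<And>k. k < m \<Longrightarrow> y k = (\<Oplus>j\<in>{..<n}. C k j \<odot> x j)"
    using generates_matrix[OF x yc] by blast
  obtain D where D: "\<And>k j. k < n \<Longrightarrow> j < m \<Longrightarrow> D k j \<in> S"
    "\<And>k. k < n \<Longrightarrow> x k = (\<Oplus>j\<in>{..<m}. D k j \<odot> y j)"
    using generates_matrix[OF y xc] by blast
  have "Determinant.det B \<in> J" if "B \<in> relation_matrices S M m y" for B
  proof -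
    have B: "B \<in> carrier_mat m m" and BS: "\<And>i j. i < m \<Longrightarrow> j < m \<Longrightarrow> B $$ (i, j) \<in> S"
      and rel: "\<And>i. i < m \<Longrightarrow> (\<Oplus>j\<in>{..<m}. B $$ (i, j) \<odot> y j) = \<zero>"
      using that by (auto simp: relation_matrices_def)
    define C' where "C' = mat m n (\<lambda>(i, j). C i j)"
    define D' where "D' = mat n m (\<lambda>(i, j). D i j)"
    have C': "C' \<in> carrier_mat m n" and D': "D' \<in> carrier_mat n m"
      by (simp_all add: C'_def D'_def)
    \<comment> \<open>A row (r, s) of the block matrix \<open>?L\<close> below stands for the
      relation r y + s x = 0: (B, 0) restates the relations of y, and (- D', 1) says x = D y.
      Multiplication by \<open>?U\<close> substitutes y = C x, so the last \<open>n\<close> entries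
      of a row of \<open>K\<close> are coefficients of a relation of x alone.\<close>
    define K where "K = four_block_mat B (B * C') (- D') (1\<^sub>m n - D' * C')"
    have K: "K \<in> carrier_mat (m + n) (m + n)"
      unfolding K_def using B C' D' by (intro four_block_carrier_mat) auto
    have mem: "(\<Sum>k<m. B $$ (i, k) * C k j) \<in> S" if "i < m" "j < n" for i j
      using that BS C(1) by (auto intro!: sum_mem mult_mem)
    have mem': "(\<Sum>k<m. D i k * C k j) \<in> S" if "i < n" "j < n" for i j
      using that C(1) D(1) by (auto intro!: sum_mem mult_mem)
    have K_upper: "K $$ (i, m + j) = (\<Sum>k<m. B $$ (i, k) * C k j)" if "i < m" "j < n" for i j
      using that B C' D' by (simp add: K_def C'_def scalar_prod_def lessThan_atLeast0)
    have K_lower: "K $$ (m + i, m + j) = (if i = j then 1 else 0) - (\<Sum>k<m. D i k * C k j)"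
      if "i < n" "j < n" for i j
      using that B C' D' by (simp add: K_def C'_def D'_def scalar_prod_def lessThan_atLeast0)
    have KS: "K $$ (i, j) \<in> S" if ij: "i < m + n" "j < m + n" for i j
    proof -
      consider "j < m" "i < m" | "j < m" "m \<le> i" | j' where "i < m" "j = m + j'" "j' < n" |
        i' j' where "i = m + i'" "i' < n" "j = m + j'" "j' < n"
        using ij by (metis add_less_cancel_left le_Suc_ex not_le)
      then show ?thesis
      proof cases
        case 2
        then have "K $$ (i, j) = - D (i - m) j"
          using B C' D' ij by (simp add: K_def D'_def)
        then show ?thesis
          using 2 ij D(1)[of "i - m" j] uminus_mem by simp
      next
        case 3
        then show ?thesis
          by (simp only: K_upper mem)
      next
        case 4
        then have "K $$ (i, j) = (if i' = j' then 1 else 0) - (\<Sum>k<m. D i' k * C k j')"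
          by (simp only: K_lower)
        then show ?thesis
          using mem'[of i' j'] 4 diff_mem by (simp del: diff_0)
      next
        case 1
        then show ?thesis
          using B BS by (simp add: K_def)
      qed
    qed
    have K_rel: "(\<Oplus>j\<in>{..<n}. K $$ (i, m + j) \<odot> x j) = \<zero>" if "i < m + n" for i
    proof (cases "i < m")
      case True
      have "(\<Oplus>j\<in>{..<n}. K $$ (i, m + j) \<odot> x j) =
          (\<Oplus>j\<in>{..<n}. (\<Sum>k<m. B $$ (i, k) * C k j) \<odot> x j)"
        using True xc mem by (intro M.finsum_cong') (auto simp: K_upper)
      also have "\<dots> = (\<Oplus>k\<in>{..<m}. B $$ (i, k) \<odot> y k)"
        using True BS C xc yc by (subst finsum_matrix_mult) (auto intro!: M.finsum_cong')
      finally show ?thesis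
        using rel[OF True] by simp
    next
      case False
      define i' where "i' = i - m"
      have i': "i = m + i'" "i' < n"
        using False that by (auto simp: i'_def)
      define u v where "u = (\<lambda>j. if i' = j then 1 else 0 :: 'a)" and "v = (\<lambda>j. \<Sum>k<m. D i' k * C k j)"
      have u: "u j \<in> S" for j
        by (simp add: u_def)
      have v: "v j \<in> S" if "j < n" for j
        using that mem' i' by (simp add: v_def)
      have eq: "K $$ (i, m + j) = u j - v j" if "j < n" for j
        using that i' by (simp add: K_lower u_def v_def)
      \<comment> \<open>Instead of subtracting in the module, the combination with coefficients
        \<open>v\<close> is added back. Both \<open>u\<close> and \<open>v\<close> produce
        \<open>x i'\<close>, so the remaining summand must vanish.\<close>
      have "(\<Oplus>j\<in>{..<n}. K $$ (i, m + j) \<odot> x j) \<oplus> (\<Oplus>j\<in>{..<n}. v j \<odot> x j) =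
          (\<Oplus>j\<in>{..<n}. (K $$ (i, m + j) + v j) \<odot> x j)"
        using v u eq xc by (intro finsum_add_coeffs[symmetric]) (auto intro: diff_mem)
      also have "\<dots> = (\<Oplus>j\<in>{..<n}. u j \<odot> x j)"
        using u xc by (intro M.finsum_cong') (auto simp: eq)
      also have "\<dots> = x i'"
        unfolding u_def using finsum_unit_vector[of i' n 1 x] i' xc smult_one[simplified] by auto
      finally have "(\<Oplus>j\<in>{..<n}. K $$ (i, m + j) \<odot> x j) \<oplus> (\<Oplus>j\<in>{..<n}. v j \<odot> x j) = x i'" .
      moreover have "(\<Oplus>j\<in>{..<n}. v j \<odot> x j) = x i'"
      proof -
        have "(\<Oplus>j\<in>{..<n}. v j \<odot> x j) = (\<Oplus>k\<in>{..<m}. D i' k \<odot> (\<Oplus>j\<in>{..<n}. C k j \<odot> x j))"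
          unfolding v_def using i' C(1) D(1) xc by (intro finsum_matrix_mult) auto
        also have "\<dots> = (\<Oplus>k\<in>{..<m}. D i' k \<odot> y k)"
          using i' C(2) D(1) yc by (intro M.finsum_cong') auto
        finally show ?thesis
          using D(2)[OF i'(2)] by simp
      qed
      moreover have "(\<Oplus>j\<in>{..<n}. K $$ (i, m + j) \<odot> x j) \<in> carrier M" "x i' \<in> carrier M"
        using i' xc u v eq diff_mem smult_closed[simplified] by (auto intro!: M.finsum_closed simp: Pi_iff)
      ultimately show ?thesis
        using M.add.r_cancel_one'[of "x i'"] by auto
    qed
    \<comment> \<open>Both factors are block triangular: \<open>?L\<close> has the determinant of
      \<open>B\<close>, and \<open>?U\<close> has determinant 1.\<close>
    let ?L = "four_block_mat B (0\<^sub>m m n) (- D') (1\<^sub>m n)"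
    let ?U = "four_block_mat (1\<^sub>m m) C' (0\<^sub>m n m) (1\<^sub>m n)"
    have "?L * ?U = four_block_mat (B * 1\<^sub>m m + 0\<^sub>m m n * 0\<^sub>m n m) (B * C' + 0\<^sub>m m n * 1\<^sub>m n)
        (- D' * 1\<^sub>m m + 1\<^sub>m n * 0\<^sub>m n m) (- D' * C' + 1\<^sub>m n * 1\<^sub>m n)"
      using B C' D' by (intro mult_four_block_mat) auto
    also have "\<dots> = K"
    proof -
      have "B * 1\<^sub>m m + 0\<^sub>m m n * 0\<^sub>m n m = B" "B * C' + 0\<^sub>m m n * 1\<^sub>m n = B * C'"
        "- D' * 1\<^sub>m m + 1\<^sub>m n * 0\<^sub>m n m = - D'"
        using B C' D' mult_carrier_mat[OF B C'] by simp_all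
      moreover have "- D' * C' + 1\<^sub>m n * 1\<^sub>m n = 1\<^sub>m n - D' * C'"
        using C' D' by (intro eq_matI) auto
      ultimately show ?thesis
        by (simp only: K_def)
    qed
    finally have "Determinant.det K = Determinant.det (?L * ?U)"
      by simp
    also have "\<dots> = Determinant.det ?L * Determinant.det ?U"
      using B C' D' by (intro det_mult[of _ "m + n"] four_block_carrier_mat) auto
    also have "Determinant.det ?L = Determinant.det B * Determinant.det (1\<^sub>m n)"
      using B D' by (intro det_four_block_mat_upper_right_zero) auto
    also have "Determinant.det ?U = Determinant.det (1\<^sub>m m) * Determinant.det (1\<^sub>m n)"
      using C' by (intro det_four_block_mat_lower_left_zero) auto
    finally have "Determinant.det K = Determinant.det B"
      by simp
    moreover have "Determinant.det K \<in> J"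
    proof (rule det_mem_ideal_of_minors[OF J K KS])
      \<comment> \<open>Any choice of rows, even with repetitions, again consists of relations of x,
        so each such minor is the determinant of a relation matrix.\<close>
      fix f :: "nat \<Rightarrow> nat" assume f: "\<And>i. i < n \<Longrightarrow> f i < m + n"
      have "(\<Oplus>j\<in>{..<n}. mat n n (\<lambda>(i, j). K $$ (f i, m + j)) $$ (i, j) \<odot> x j) = \<zero>" if "i < n" for i
      proof -
        have "(\<Oplus>j\<in>{..<n}. mat n n (\<lambda>(i, j). K $$ (f i, m + j)) $$ (i, j) \<odot> x j) =
            (\<Oplus>j\<in>{..<n}. K $$ (f i, m + j) \<odot> x j)"
          using that f KS xc by (intro M.finsum_cong') auto
        then show ?thesis
          using K_rel f that by simp
      qed
      then show "Determinant.det (mat n n (\<lambda>(i, j). K $$ (f i, m + j))) \<in> J"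
        using f KS by (intro J_mem) (auto simp: relation_matrices_def)
    qed
    ultimately show ?thesis
      by simp
  qed
  then show ?thesis
    unfolding J_def[symmetric] by (intro R.genideal_minimal[OF J]) auto
qed

text \<open>All that is known of the family picked by \<open>SOME\<close> is that it generates.
  Comparing it with the given family in both directions identifies the two ideals.\<close>

lemma fitting0_eq:
  assumes "generates (subset_ring S) M n x"
  shows "fitting0 S M = Idl\<^bsub>subset_ring S\<^esub> (Determinant.det ` relation_matrices S M n x)"
proof -
  obtain m y where my: "(SOME (n, x). generates (subset_ring S) M n x) = (m, y)"
    by fastforce
  have "case (m, y) of (n, x) \<Rightarrow> generates (subset_ring S) M n x"
    unfolding my[symmetric] by (rule someI[of _ "(n, x)"]) (use assms in simp)
  then have "generates (subset_ring S) M m y"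
    by simp
  then show ?thesis
    using fitting_ideal_mono[of n x m y] fitting_ideal_mono[of m y n x] assms
    by (simp add: fitting0_def my)
qed

text \<open>The adjugate times \<open>B\<close> is \<open>det B\<close> times the identity, so
  \<open>det B\<close> times a generator is a combination of the relations in the rows of
  \<open>B\<close>. The adjugate has entries in \<open>S\<close> because they are signed minors of
  \<open>B\<close>.\<close>

lemma det_relation_matrix_annihilates:
  assumes x: "generates (subset_ring S) M n x" and "B \<in> relation_matrices S M n x" "y \<in> carrier M"
  shows "Determinant.det B \<odot> y = \<zero>"
proof -
  have B: "B \<in> carrier_mat n n" and BS: "\<And>i j. i < n \<Longrightarrow> j < n \<Longrightarrow> B $$ (i, j) \<in> S"
    and rel: "\<And>i. i < n \<Longrightarrow> (\<Oplus>j\<in>{..<n}. B $$ (i, j) \<odot> x j) = \<zero>"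
    using assms by (auto simp: relation_matrices_def)
  have xc: "x \<in> {..<n} \<rightarrow> carrier M"
    using x by (auto simp: generates_def)
  have det: "Determinant.det B \<in> S"
    using B BS by (rule det_mem)
  have adj: "adj_mat B $$ (i, j) \<in> S" if "i < n" "j < n" for i j
  proof -
    have "Determinant.det (mat_delete B j i) \<in> S"
      using that B mat_delete_carrier[OF B, of j i] by (intro det_mem) (auto simp: mat_delete_def intro!: BS)
    then show ?thesis
      using that B by (simp add: adj_mat_def cofactor_def mult_mem)
  qed
  have gen: "Determinant.det B \<odot> x i = \<zero>" if i: "i < n" for i
  proof -
    have "(\<Sum>k<n. adj_mat B $$ (i, k) * B $$ (k, j)) = (if i = j then Determinant.det B else 0)"
      if "j < n" for j
    proof -
      have "(adj_mat B * B) $$ (i, j) = (\<Sum>k<n. adj_mat B $$ (i, k) * B $$ (k, j))"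
        using adj_mat(1)[OF B] B i that by (auto simp: scalar_prod_def lessThan_atLeast0)
      then show ?thesis
        using adj_mat(3)[OF B] i that by (simp flip: \<open>(adj_mat B * B) $$ (i, j) = _\<close>)
    qed
    then have "Determinant.det B \<odot> x i =
        (\<Oplus>j\<in>{..<n}. (\<Sum>k<n. adj_mat B $$ (i, k) * B $$ (k, j)) \<odot> x j)"
      using i xc det by (subst finsum_unit_vector[symmetric, of i n _ x]) (auto intro!: M.finsum_cong')
    also have "\<dots> = (\<Oplus>k\<in>{..<n}. adj_mat B $$ (i, k) \<odot> (\<Oplus>j\<in>{..<n}. B $$ (k, j) \<odot> x j))"
      using i adj BS xc by (intro finsum_matrix_mult) auto
    also have "\<dots> = \<zero>"
      using rel adj i smult_r_null[simplified] by (intro M.add.finprod_one_eqI) auto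
    finally show ?thesis .
  qed
  obtain a where a: "a \<in> {..<n} \<rightarrow> S" and y: "y = (\<Oplus>i\<in>{..<n}. a i \<odot> x i)"
    using x assms(3) by (auto simp: generates_def)
  have "Determinant.det B \<odot> y = (\<Oplus>i\<in>{..<n}. Determinant.det B \<odot> (a i \<odot> x i))"
    unfolding y using a det xc smult_closed[simplified]
    by (intro finsum_smult_ldistr) (auto simp: Pi_iff)
  also have "\<dots> = \<zero>"
  proof (rule M.add.finprod_one_eqI)
    fix i assume i: "i \<in> {..<n}"
    then have ai: "a i \<in> S" and xi: "x i \<in> carrier M"
      using a xc by auto
    have "Determinant.det B \<odot> (a i \<odot> x i) = (Determinant.det B * a i) \<odot> x i"
      using smult_assoc1[simplified, OF det ai xi] by simp
    also have "\<dots> = a i \<odot> (Determinant.det B \<odot> x i)"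
      using smult_assoc1[simplified, OF ai det xi] by (simp only: mult.commute)
    finally show "Determinant.det B \<odot> (a i \<odot> x i) = \<zero>"
      using gen i smult_r_null[simplified, OF ai] by simp
  qed
  finally show ?thesis .
qed

end

section \<open>Multiplication matrices modulo a monic polynomial\<close>

lemma coeff_sum_monom:
  fixes n :: nat
  shows "Polynomial.coeff (\<Sum>j<n. Polynomial.monom (c j) j) i = (if i < n then c i else 0)"
  by (simp add: coeff_sum if_distrib sum.delta cong: if_cong)

text \<open>The bound is put on coefficients rather than on \<open>degree r\<close>: for constant P
  no polynomial has smaller degree, not even 0, whereas this condition then correctly forces r =
  0.\<close>

lemma dvd_low_degree_eq_0:
  fixes P r :: "'a::idom poly"
  assumes "P dvd r" "\<And>i. i \<ge> Polynomial.degree P \<Longrightarrow> Polynomial.coeff r i = 0"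
  shows "r = 0"
proof (rule ccontr)
  assume "r \<noteq> 0"
  then have "Polynomial.degree P \<le> Polynomial.degree r"
    using assms(1) by (rule dvd_imp_degree_le[rotated])
  then show False
    using assms(2)[of "Polynomial.degree r"] \<open>r \<noteq> 0\<close> by simp
qed

section \<open>Division with remainder by a monic polynomial over a subring\<close>

context subring_set
begin

lemma subring_set_poly_over: "subring_set (poly_over S)"
proof
  show "1 \<in> poly_over S"
    by (simp add: poly_over_def coeff_1)
qed (auto simp: poly_over_def coeff_mult intro: add_mem uminus_mem mult_mem sum_mem)

lemma monom_mem_poly_over: "c \<in> S \<Longrightarrow> Polynomial.monom c i \<in> poly_over S"
  by (simp add: poly_over_def)

lemma const_mem_poly_over: "c \<in> S \<Longrightarrow> [:c:] \<in> poly_over S"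
  by (simp add: poly_over_def coeff_pCons split: nat.split)

text \<open>Long division only ever divides by the leading coefficient 1, so quotient and remainder
  stay over \<open>S\<close>. The induction runs over a bound \<open>k\<close> from which on the
  coefficients of f vanish; subtracting the monomial multiple \<open>m * P\<close> clears the top
  one.\<close>

lemma monic_division:
  assumes P: "lead_coeff P = 1" "P \<in> poly_over S" and f: "f \<in> poly_over S"
  obtains q r where "q \<in> poly_over S" "r \<in> poly_over S" "f = q * P + r"
    "\<And>i. i \<ge> Polynomial.degree P \<Longrightarrow> Polynomial.coeff r i = 0"
proof -
  interpret X: subring_set "poly_over S"
    by (rule subring_set_poly_over)
  have "\<exists>q r. q \<in> poly_over S \<and> r \<in> poly_over S \<and> f = q * P + r \<and>
      (\<forall>i \<ge> Polynomial.degree P. Polynomial.coeff r i = 0)"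
    if "\<And>i. i \<ge> k \<Longrightarrow> Polynomial.coeff f i = 0" "f \<in> poly_over S" for k f
    using that
  proof (induction k arbitrary: f)
    case 0
    then show ?case
      by (intro exI[of _ 0] exI[of _ f]) auto
  next
    case (Suc k)
    show ?case
    proof (cases "k < Polynomial.degree P")
      case True
      then show ?thesis
        using Suc.prems by (intro exI[of _ 0] exI[of _ f]) auto
    next
      case False
      define m where "m = Polynomial.monom (Polynomial.coeff f k) (k - Polynomial.degree P)"
      have m: "m \<in> poly_over S"
        unfolding m_def using Suc.prems(2) by (intro monom_mem_poly_over) (simp add: poly_over_def)
      have "Polynomial.coeff (f - m * P) i = 0" if "i \<ge> k" for i
      proof (cases "i = k")
        case True
        then show ?thesis
          using False P(1) by (simp add: m_def coeff_monom_mult)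
      next
        case False
        then show ?thesis
          using that Suc.prems(1)[of i] \<open>\<not> k < Polynomial.degree P\<close>
          by (auto simp: m_def coeff_monom_mult intro!: coeff_eq_0)
      qed
      moreover have "f - m * P \<in> poly_over S"
        using Suc.prems m P by (intro X.diff_mem X.mult_mem)
      ultimately obtain q r where qr: "q \<in> poly_over S" "r \<in> poly_over S" "f - m * P = q * P + r"
        "\<forall>i \<ge> Polynomial.degree P. Polynomial.coeff r i = 0"
        using Suc.IH[of "f - m * P"] by blast
      then have "f = (q + m) * P + r"
        by (simp add: algebra_simps)
      then show ?thesis
        using qr m X.add_mem by blast
    qed
  qed
  from this[of "Suc (Polynomial.degree f)" f] show ?thesis
    using that f by (metis Suc_le_lessD coeff_eq_0)
qed

text \<open>Dividing over \<open>S\<close> gives a second quotient; the remainder is a multiple of P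
  of low degree, hence 0, and the quotients agree. This permits ambient divisibility by P to replace
  membership in the ideal over \<open>S\<close>.\<close>

lemma quotient_mem_poly_over:
  assumes P: "lead_coeff P = 1" "P \<in> poly_over S" and "q * P \<in> poly_over S"
  shows "q \<in> poly_over S"
proof -
  obtain q' r where qr: "q' \<in> poly_over S" "r \<in> poly_over S" "q * P = q' * P + r"
    "\<And>i. i \<ge> Polynomial.degree P \<Longrightarrow> Polynomial.coeff r i = 0"
    using monic_division[OF P assms(3)] by blast
  have "r = (q - q') * P"
    using qr(3) by (simp add: algebra_simps)
  then have "r = 0"
    using qr(4) by (intro dvd_low_degree_eq_0[of P]) auto
  then show ?thesis
    using qr P(1) by auto
qed

end

text \<open>Row i holds the coordinates of F times the i-th power of the variable, modulo P. Stating
  this as a congruence instead of through remainders lets products and ring homomorphisms act on it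
  directly.\<close>

definition is_mult_matrix :: "'a::idom poly \<Rightarrow> 'a poly \<Rightarrow> 'a mat \<Rightarrow> bool" where
  "is_mult_matrix P F A \<longleftrightarrow> A \<in> carrier_mat (Polynomial.degree P) (Polynomial.degree P) \<and>
     (\<forall>i<Polynomial.degree P. P dvd Polynomial.monom 1 i * F -
        (\<Sum>j<Polynomial.degree P. Polynomial.monom (A $$ (i, j)) j))"

lemma is_mult_matrixD:
  assumes "is_mult_matrix P F A" "i < Polynomial.degree P"
  shows "P dvd Polynomial.monom 1 i * F - (\<Sum>j<Polynomial.degree P. Polynomial.monom (A $$ (i, j)) j)"
  using assms by (simp add: is_mult_matrix_def)

lemma (in subring_set) ex_mult_matrix:
  assumes "lead_coeff P = 1" "P \<in> poly_over S" "F \<in> poly_over S"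
  obtains A where "is_mult_matrix P F A"
    "\<And>i j. i < Polynomial.degree P \<Longrightarrow> j < Polynomial.degree P \<Longrightarrow> A $$ (i, j) \<in> S"
proof -
  interpret X: subring_set "poly_over S"
    by (rule subring_set_poly_over)
  have "\<exists>r. r \<in> poly_over S \<and> P dvd Polynomial.monom 1 i * F - r \<and>
      (\<forall>i \<ge> Polynomial.degree P. Polynomial.coeff r i = 0)" for i
  proof -
    have "Polynomial.monom 1 i * F \<in> poly_over S"
      using assms by (intro X.mult_mem monom_mem_poly_over) auto
    then obtain q r where "r \<in> poly_over S" "Polynomial.monom 1 i * F = q * P + r"
      "\<And>i. i \<ge> Polynomial.degree P \<Longrightarrow> Polynomial.coeff r i = 0"
      using monic_division[OF assms(1,2)] by metis
    then show ?thesis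
      by (intro exI[of _ r]) auto
  qed
  then obtain r where r: "\<And>i. r i \<in> poly_over S" "\<And>i. P dvd Polynomial.monom 1 i * F - r i"
    "\<And>i j. j \<ge> Polynomial.degree P \<Longrightarrow> Polynomial.coeff (r i) j = 0"
    by metis
  define A where "A = mat (Polynomial.degree P) (Polynomial.degree P) (\<lambda>(i, j). Polynomial.coeff (r i) j)"
  have "(\<Sum>j<Polynomial.degree P. Polynomial.monom (A $$ (i, j)) j) = r i" if "i < Polynomial.degree P" for i
    by (rule poly_eqI) (use that r(3) in \<open>auto simp: coeff_sum_monom A_def\<close>)
  then have "is_mult_matrix P F A"
    using r(2) by (auto simp: is_mult_matrix_def A_def)
  moreover have "A $$ (i, j) \<in> S" if "i < Polynomial.degree P" "j < Polynomial.degree P" for i j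
    using that r(1) by (auto simp: A_def poly_over_def)
  ultimately show ?thesis
    by (rule that)
qed

text \<open>The powers of the variable below \<open>degree P\<close> are linearly independent modulo
  P, so the coordinates are determined.\<close>

lemma is_mult_matrix_unique:
  assumes A: "is_mult_matrix P F A" and B: "is_mult_matrix P F B"
  shows "A = B"
proof (rule eq_matI)
  fix i j assume ij: "i < dim_row B" "j < dim_col B"
  let ?n = "Polynomial.degree P"
  have i: "i < ?n" and j: "j < ?n"
    using ij B by (auto simp: is_mult_matrix_def)
  define r where "r = (\<Sum>j<?n. Polynomial.monom (B $$ (i, j)) j) - (\<Sum>j<?n. Polynomial.monom (A $$ (i, j)) j)"
  have r_eq: "r = (Polynomial.monom 1 i * F - (\<Sum>j<?n. Polynomial.monom (A $$ (i, j)) j)) -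
      (Polynomial.monom 1 i * F - (\<Sum>j<?n. Polynomial.monom (B $$ (i, j)) j))"
    by (simp add: r_def)
  have "P dvd r"
    unfolding r_eq using is_mult_matrixD[OF A i] is_mult_matrixD[OF B i] by (rule dvd_diff)
  then have "r = 0"
    by (rule dvd_low_degree_eq_0) (simp add: r_def coeff_sum_monom)
  moreover have "Polynomial.coeff r j = B $$ (i, j) - A $$ (i, j)"
    using j by (simp add: r_def coeff_sum_monom)
  ultimately show "A $$ (i, j) = B $$ (i, j)"
    by simp
qed (use A B in \<open>auto simp: is_mult_matrix_def\<close>)

lemma is_mult_matrix_one: "is_mult_matrix P 1 (1\<^sub>m (Polynomial.degree P))"
proof -
  have row: "(\<Sum>j<Polynomial.degree P. Polynomial.monom (1\<^sub>m (Polynomial.degree P) $$ (i, j)) j) =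
      Polynomial.monom 1 i" if "i < Polynomial.degree P" for i
    by (rule poly_eqI) (use that in \<open>auto simp: coeff_sum_monom\<close>)
  show ?thesis
    unfolding is_mult_matrix_def
  proof (intro conjI allI impI one_carrier_mat)
    fix i assume "i < Polynomial.degree P"
    then show "P dvd Polynomial.monom 1 i * 1 -
        (\<Sum>j<Polynomial.degree P. Polynomial.monom (1\<^sub>m (Polynomial.degree P) $$ (i, j)) j)"
      by (subst row) simp_all
  qed
qed

text \<open>With coordinates in rows, expand the i-th power times F by row i of \<open>A\<close>,
  multiply by G, and expand each power times G by the rows of \<open>B\<close>. The total error is
  the error for F times G plus the errors for G weighted by row i of \<open>A\<close>; both are
  divisible by P.\<close>

lemma is_mult_matrix_mult:
  assumes A: "is_mult_matrix P F A" and B: "is_mult_matrix P G B"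
  shows "is_mult_matrix P (F * G) (A * B)"
  unfolding is_mult_matrix_def
proof (intro conjI allI impI)
  let ?n = "Polynomial.degree P"
  have Ac: "A \<in> carrier_mat ?n ?n" and Bc: "B \<in> carrier_mat ?n ?n"
    using A B by (auto simp: is_mult_matrix_def)
  then show "A * B \<in> carrier_mat ?n ?n"
    by simp
  fix i assume i: "i < ?n"
  define b where "b j = (\<Sum>k<?n. Polynomial.monom (B $$ (j, k)) k)" for j
  have "(\<Sum>k<?n. Polynomial.monom ((A * B) $$ (i, k)) k) =
      (\<Sum>k<?n. \<Sum>j<?n. Polynomial.monom (A $$ (i, j) * B $$ (j, k)) k)"
    using i Ac Bc by (intro sum.cong) (auto simp: scalar_prod_def lessThan_atLeast0 monom_sum)
  also have "\<dots> = (\<Sum>j<?n. [:A $$ (i, j):] * b j)"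
    unfolding b_def by (subst sum.swap) (simp add: sum_distrib_left smult_monom)
  finally have AB: "(\<Sum>k<?n. Polynomial.monom ((A * B) $$ (i, k)) k) = (\<Sum>j<?n. [:A $$ (i, j):] * b j)" .
  have "(\<Sum>j<?n. [:A $$ (i, j):] * (Polynomial.monom 1 j * G - b j)) =
      (\<Sum>j<?n. Polynomial.monom (A $$ (i, j)) j * G - [:A $$ (i, j):] * b j)"
    by (intro sum.cong) (simp_all add: right_diff_distrib smult_monom flip: mult_smult_left)
  also have "\<dots> = (\<Sum>j<?n. Polynomial.monom (A $$ (i, j)) j) * G - (\<Sum>j<?n. [:A $$ (i, j):] * b j)"
    by (simp only: sum_subtractf sum_distrib_right)
  finally have "Polynomial.monom 1 i * (F * G) - (\<Sum>k<?n. Polynomial.monom ((A * B) $$ (i, k)) k) =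
      (Polynomial.monom 1 i * F - (\<Sum>j<?n. Polynomial.monom (A $$ (i, j)) j)) * G +
      (\<Sum>j<?n. [:A $$ (i, j):] * (Polynomial.monom 1 j * G - b j))"
    unfolding AB by (simp only: left_diff_distrib mult.assoc) simp
  moreover have "P dvd (Polynomial.monom 1 i * F - (\<Sum>j<?n. Polynomial.monom (A $$ (i, j)) j)) * G"
    using is_mult_matrixD[OF A i] by (rule dvd_mult2)
  moreover have "P dvd (\<Sum>j<?n. [:A $$ (i, j):] * (Polynomial.monom 1 j * G - b j))"
    unfolding b_def using is_mult_matrixD[OF B] by (intro dvd_sum dvd_mult) simp
  ultimately show "P dvd Polynomial.monom 1 i * (F * G) - (\<Sum>k<?n. Polynomial.monom ((A * B) $$ (i, k)) k)"
    using dvd_add by (simp only:)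
qed

text \<open>In the induction step the first column contains only \<open>c\<close> at the top and
  \<open>q 0\<close> at the bottom. The first cofactor has the same shape with \<open>q\<close>
  shifted, the second is a triangular determinant with unit diagonal; the resulting recursion is
  Horner's scheme at \<open>- c\<close>.\<close>

lemma det_companion:
  fixes c :: "'a::comm_ring_1"
  shows "Determinant.det (mat (Suc n) (Suc n) (\<lambda>(i, j). if i < n then if j = Suc i then 1 else
      if j = i then c else 0 else q j)) = (- 1) ^ n * (\<Sum>j<Suc n. q j * (- c) ^ j)"
proof (induction n arbitrary: q)
  case 0
  then show ?case
    by (subst det_single) auto
next
  case (Suc n)
  define M where "M = mat (Suc (Suc n)) (Suc (Suc n)) (\<lambda>(i, j). if i < Suc n then if j = Suc i then 1 else
      if j = i then c else 0 else q j)"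
  have M: "M \<in> carrier_mat (Suc (Suc n)) (Suc (Suc n))"
    by (simp add: M_def)
  have "mat_delete M 0 0 = mat (Suc n) (Suc n) (\<lambda>(i, j). if i < n then if j = Suc i then 1 else
      if j = i then c else 0 else q (Suc j))"
    by (rule eq_matI) (auto simp: mat_delete_def M_def)
  then have first: "cofactor M 0 0 = (- 1) ^ n * (\<Sum>j<Suc n. q (Suc j) * (- c) ^ j)"
    using Suc.IH[of "\<lambda>j. q (Suc j)"] by (simp add: cofactor_def)
  have D: "mat_delete M (Suc n) 0 = mat (Suc n) (Suc n) (\<lambda>(i, j). if j = i then 1 else
      if Suc j = i then c else 0)"
    by (rule eq_matI) (auto simp: mat_delete_def M_def)
  have "Determinant.det (mat_delete M (Suc n) 0) = 1"
    unfolding D by (subst det_lower_triangular[of "Suc n"]) (auto simp: prod_list_diag_prod)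
  then have last: "cofactor M (Suc n) 0 = (- 1) ^ Suc n"
    by (simp add: cofactor_def)
  have "Determinant.det M = (\<Sum>i<Suc (Suc n). M $$ (i, 0) * cofactor M i 0)"
    by (rule laplace_expansion_column[OF M]) simp
  also have "\<dots> = (\<Sum>i\<in>{0, Suc n}. M $$ (i, 0) * cofactor M i 0)"
    by (rule sum.mono_neutral_right) (auto simp: M_def)
  also have "\<dots> = c * ((- 1) ^ n * (\<Sum>j<Suc n. q (Suc j) * (- c) ^ j)) + q 0 * (- 1) ^ Suc n"
    using first last by (simp add: M_def)
  also have "\<dots> = (- 1) ^ Suc n * (q 0 * (- c) ^ 0 + (\<Sum>j<Suc n. q (Suc j) * (- c) ^ Suc j))"
    by (simp add: algebra_simps sum_distrib_left del: sum.lessThan_Suc)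
  also have "q 0 * (- c) ^ 0 + (\<Sum>j<Suc n. q (Suc j) * (- c) ^ Suc j) = (\<Sum>j<Suc (Suc n). q j * (- c) ^ j)"
    by (rule sum.lessThan_Suc_shift[symmetric])
  finally show ?case
    by (simp only: M_def)
qed

text \<open>Multiplying a power by \<open>[:- \<xi>, 1:]\<close> gives the next power minus
  \<open>\<xi>\<close> times the same one. Only in the last row does this reach degree
  \<open>degree P\<close> and require a reduction, namely one subtraction of P.\<close>

lemma det_mult_matrix_linear:
  assumes P: "lead_coeff P = 1" and A: "is_mult_matrix P [:- \<xi>, 1:] A"
  shows "Determinant.det A = (- 1) ^ Polynomial.degree P * poly P \<xi>"
proof (cases "Polynomial.degree P")
  \<comment> \<open>Here P = 1, the matrix is empty and its determinant is 1; the companion shape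
    needs a last row, so this case stands apart.\<close>
  case 0
  then have "P = 1"
    using P by (metis degree_0_id of_nat_1 one_pCons pCons_0_as_mult lead_coeff_monom monom_0)
  then show ?thesis
    using A by (simp add: is_mult_matrix_def)
next
  case (Suc n)
  \<comment> \<open>These are the coefficients below \<open>Suc n\<close> of the last power times
    \<open>[:- \<xi>, 1:]\<close> minus P, that is, of the reduced last row.\<close>
  define q where "q j = - Polynomial.coeff P j - (if j = n then \<xi> else 0)" for j
  define C where "C = mat (Suc n) (Suc n) (\<lambda>(i, j). if i < n then if j = Suc i then 1 else
      if j = i then - \<xi> else 0 else q j)"
  have "is_mult_matrix P [:- \<xi>, 1:] C"
    unfolding is_mult_matrix_def Suc
  proof (intro conjI allI impI)
    fix i assume i: "i < Suc n"
    have X: "Polynomial.coeff (Polynomial.monom 1 i * [:- \<xi>, 1:]) k =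
        (if k = Suc i then 1 else if k = i then - \<xi> else 0)" for k
      by (auto simp: coeff_monom_mult coeff_pCons split: nat.split)
    show "P dvd Polynomial.monom 1 i * [:- \<xi>, 1:] - (\<Sum>j<Suc n. Polynomial.monom (C $$ (i, j)) j)"
    proof (cases "i < n")
      case True
      then have "Polynomial.monom 1 i * [:- \<xi>, 1:] = (\<Sum>j<Suc n. Polynomial.monom (C $$ (i, j)) j)"
        by (intro poly_eqI) (auto simp only: X coeff_sum_monom, auto simp: C_def)
      then show ?thesis
        by simp
    next
      case False
      then have "i = n"
        using i by simp
      have "Polynomial.monom 1 i * [:- \<xi>, 1:] - (\<Sum>j<Suc n. Polynomial.monom (C $$ (i, j)) j) = P"
      proof (rule poly_eqI)
        fix k
        have "k > Suc n \<Longrightarrow> Polynomial.coeff P k = 0"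
          using Suc by (intro coeff_eq_0) simp
        moreover have "Polynomial.coeff P (Suc n) = 1"
          using P Suc by simp
        ultimately show "Polynomial.coeff (Polynomial.monom 1 i * [:- \<xi>, 1:] -
            (\<Sum>j<Suc n. Polynomial.monom (C $$ (i, j)) j)) k = Polynomial.coeff P k"
          using \<open>i = n\<close> unfolding coeff_diff X coeff_sum_monom
          by (cases "k = Suc n"; cases "k < Suc n") (auto simp: C_def q_def)
      qed
      then show ?thesis
        by simp
    qed
  qed (simp add: C_def)
  then have "A = C"
    using A is_mult_matrix_unique by blast
  then have "Determinant.det A = (- 1) ^ n * (\<Sum>j<Suc n. q j * \<xi> ^ j)"
    using det_companion[of n "- \<xi>" q] by (simp only: C_def minus_minus)
  \<comment> \<open>The extra \<open>\<xi>\<close> in \<open>q n\<close> supplies the leading term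
    of P at \<open>\<xi>\<close>, and the minus sign turns \<open>(- 1) ^ n\<close> into
    \<open>(- 1) ^ degree P\<close>.\<close>
  also have "(\<Sum>j<Suc n. q j * \<xi> ^ j) = - poly P \<xi>"
  proof -
    have "poly P \<xi> = (\<Sum>j<Suc n. Polynomial.coeff P j * \<xi> ^ j) + \<xi> ^ Suc n"
      using P Suc by (simp add: poly_altdef lessThan_Suc_atMost)
    moreover have "(\<Sum>j<Suc n. q j * \<xi> ^ j) =
        - (\<Sum>j<Suc n. Polynomial.coeff P j * \<xi> ^ j) - (\<Sum>j<Suc n. (if j = n then \<xi> else 0) * \<xi> ^ j)"
      by (simp only: q_def left_diff_distrib sum_subtractf mult_minus_left sum_negf)
    moreover have "(\<Sum>j<Suc n. (if j = n then \<xi> else 0) * \<xi> ^ j) = \<xi> ^ Suc n"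
      by simp
    ultimately show ?thesis
      by simp
  qed
  finally show ?thesis
    using Suc by simp
qed

text \<open>One linear factor is removed at a time. The roots are arbitrary elements, so the
  matrices of the factors are taken over the whole ring, which is the subring lemma for
  \<open>UNIV\<close>.\<close>

lemma det_mult_matrix_split:
  assumes P: "lead_coeff P = 1" and A: "is_mult_matrix P (\<Prod>x\<in>#Z. [:- x, 1:]) A"
  shows "Determinant.det A = (\<Prod>x\<in>#Z. (- 1) ^ Polynomial.degree P * poly P x)"
  using A
proof (induction Z arbitrary: A)
  case empty
  then have "A = 1\<^sub>m (Polynomial.degree P)"
    by (intro is_mult_matrix_unique[OF _ is_mult_matrix_one]) simp
  then show ?case
    by simp
next
  case (add x Z)
  interpret U: subring_set "UNIV :: 'a set"
    by unfold_locales auto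
  have P': "P \<in> poly_over UNIV"
    by (simp add: poly_over_def)
  obtain B where B: "is_mult_matrix P [:- x, 1:] B"
    using U.ex_mult_matrix[OF P P', of "[:- x, 1:]"] by (auto simp: poly_over_def)
  obtain C where C: "is_mult_matrix P (\<Prod>x\<in>#Z. [:- x, 1:]) C"
    using U.ex_mult_matrix[OF P P', of "\<Prod>x\<in>#Z. [:- x, 1:]"] by (auto simp: poly_over_def)
  have "A = B * C"
    by (rule is_mult_matrix_unique[OF _ is_mult_matrix_mult[OF B C]]) (use add.prems in simp)
  then have "Determinant.det A = Determinant.det B * Determinant.det C"
    using B C by (auto simp: is_mult_matrix_def intro: det_mult)
  then show ?case
    using add.IH[OF C] det_mult_matrix_linear[OF P B] by simp
qed

text \<open>A homomorphism carries a congruence modulo P to one modulo the image of P; injectivity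
  keeps the degree of P and with it the size of the matrix.\<close>

lemma is_mult_matrix_hom:
  fixes h :: "'a::idom \<Rightarrow> 'b::idom"
  assumes "inj_idom_hom h" "is_mult_matrix P F A"
  shows "is_mult_matrix (map_poly h P) (map_poly h F) (map_mat h A)"
proof -
  interpret h: inj_idom_hom h by fact
  interpret hp: map_poly_inj_idom_hom h ..
  let ?n = "Polynomial.degree P"
  have deg: "Polynomial.degree (map_poly h P) = ?n"
    by simp
  have A: "A \<in> carrier_mat ?n ?n"
    using assms(2) by (simp add: is_mult_matrix_def)
  have "map_poly h P dvd Polynomial.monom 1 i * map_poly h F -
      (\<Sum>j<?n. Polynomial.monom (map_mat h A $$ (i, j)) j)" if i: "i < ?n" for i
  proof -
    obtain g where g: "Polynomial.monom 1 i * F - (\<Sum>j<?n. Polynomial.monom (A $$ (i, j)) j) = P * g"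
      using is_mult_matrixD[OF assms(2) i] by (elim dvdE)
    have "Polynomial.monom 1 i * map_poly h F - (\<Sum>j<?n. Polynomial.monom (map_mat h A $$ (i, j)) j) =
        map_poly h (Polynomial.monom 1 i * F - (\<Sum>j<?n. Polynomial.monom (A $$ (i, j)) j))"
      using A i by (simp add: hom_distribs)
    also have "\<dots> = map_poly h P * map_poly h g"
      unfolding g by (simp add: hom_distribs)
    finally show ?thesis
      by simp
  qed
  then show ?thesis
    using A by (simp add: is_mult_matrix_def)
qed

section \<open>From determinants to resultants\<close>

lemma inj_idom_hom_to_ac_to_fract: "inj_idom_hom (\<lambda>c::'a::idom. to_ac (to_fract c))"
  by unfold_locales auto

text \<open>The determinant is computed in the base ring and exhibits there an element whose image
  is the product over the roots. Together with injectivity of the embedding this makes the definite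
  description in \<open>monic_resultant\<close> meaningful.\<close>

lemma monic_resultant_eq_det:
  fixes F P :: "'a::idom poly"
  assumes F: "lead_coeff F = 1" and P: "lead_coeff P = 1" and A: "is_mult_matrix P F A"
  shows "monic_resultant F P = (- 1) ^ (Polynomial.degree P * Polynomial.degree F) * Determinant.det A"
proof -
  define h where "h = (\<lambda>c::'a. to_ac (to_fract c))"
  have h: "inj_idom_hom h"
    unfolding h_def by (rule inj_idom_hom_to_ac_to_fract)
  interpret h: inj_idom_hom h by fact
  interpret hp: map_poly_inj_idom_hom h ..
  define F' where "F' = map_poly h F"
  define P' where "P' = map_poly h P"
  have lead: "lead_coeff F' = 1" "lead_coeff P' = 1"
    using F P by (simp_all add: F'_def P'_def)
  have deg: "Polynomial.degree F' = Polynomial.degree F" "Polynomial.degree P' = Polynomial.degree P"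
    by (simp_all add: F'_def P'_def)
  obtain Z where Z: "size Z = Polynomial.degree F'" "F' = (\<Prod>x\<in>#Z. [:- x, 1:])"
    using alg_closed_imp_factorization[of F'] lead by fastforce
  have "proots (\<Prod>x\<in>#Z. [:- x, 1:]) = Z"
    proof (induction Z)
    case (add x Z)
    have "(\<Prod>x\<in>#Z. [:- x, 1:]) \<noteq> 0"
      by (auto simp: prod_mset_zero_iff)
    then have "proots ([:- x, 1:] * (\<Prod>x\<in>#Z. [:- x, 1:])) = {#x#} + Z"
      using add proots_linear_factor[of "- x"] by (subst proots_mult) auto
    then show ?case
      by simp
  qed simp
  then have roots: "proots F' = Z"
    using Z by simp
  \<comment> \<open>Each of the \<open>degree F\<close> roots contributes a factor
    \<open>(- 1) ^ degree P\<close>; the sign in front cancels all of them.\<close>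
  define R where "R = (- 1) ^ (Polynomial.degree P * Polynomial.degree F) * Determinant.det A"
  have "h (Determinant.det A) = Determinant.det (map_mat h A)"
    by simp
  also have "\<dots> = (\<Prod>x\<in>#Z. (- 1) ^ Polynomial.degree P' * poly P' x)"
    using is_mult_matrix_hom[OF h A] lead(2) Z(2)
    by (intro det_mult_matrix_split) (simp_all add: F'_def P'_def)
  also have "\<dots> = ((- 1) ^ Polynomial.degree P') ^ size Z * (\<Prod>x\<in>#Z. poly P' x)"
    by (simp add: prod_mset.distrib)
  finally have "h R = (- 1) ^ (Polynomial.degree P * Polynomial.degree F) *
      ((- 1) ^ (Polynomial.degree P * Polynomial.degree F) * (\<Prod>x\<in>#Z. poly P' x))"
    by (simp add: R_def hom_distribs Z(1) deg power_mult)
  also have "\<dots> = (\<Prod>x\<in>#Z. poly P' x)"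
    by (simp flip: mult.assoc power_mult_distrib)
  finally have "h R = (\<Prod>x\<in>#proots F'. poly P' x)"
    using roots by simp
  then have "(THE r. h r = (\<Prod>x\<in>#proots F'. poly P' x)) = R"
    by (intro the_equality) (metis h.eq_iff)+
  then show ?thesis
    by (simp only: monic_resultant_def F'_def P'_def h_def R_def)
qed

section \<open>Quotient modules\<close>

context Module.module
begin

lemma abelian_subgroup_submodule:
  assumes "submodule H R M"
  shows "abelian_subgroup H M"
  using assms by (intro abelian_subgroupI3 additive_subgroup.intro M.abelian_group_axioms)
    (simp add: submodule_def)

text \<open>Scalar multiplication on cosets is a union over representatives. Closure of
  \<open>H\<close> under scalars makes all members of that union the same coset.\<close>

lemma quot_module_smult:
  assumes H: "submodule H R M" and "a \<in> carrier R" "x \<in> carrier M"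
  shows "a \<odot>\<^bsub>quot_module M H\<^esub> (H +>\<^bsub>M\<^esub> x) = H +>\<^bsub>M\<^esub> (a \<odot>\<^bsub>M\<^esub> x)"
proof -
  interpret H: abelian_subgroup H M
    using H by (rule abelian_subgroup_submodule)
  have coset: "H +>\<^bsub>M\<^esub> (a \<odot>\<^bsub>M\<^esub> y) = H +>\<^bsub>M\<^esub> (a \<odot>\<^bsub>M\<^esub> x)" if y: "y \<in> H +>\<^bsub>M\<^esub> x" for y
  proof -
    obtain h where h: "h \<in> H" "y = h \<oplus>\<^bsub>M\<^esub> x"
      using y by (auto simp: a_r_coset_def')
    have "h \<in> carrier M"
      using h H.a_subset by auto
    then have "H +>\<^bsub>M\<^esub> (a \<odot>\<^bsub>M\<^esub> y) = (H +>\<^bsub>M\<^esub> (a \<odot>\<^bsub>M\<^esub> h)) <+>\<^bsub>M\<^esub> (H +>\<^bsub>M\<^esub> (a \<odot>\<^bsub>M\<^esub> x))"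
      using assms h by (simp add: smult_r_distr H.a_rcos_sum)
    also have "H +>\<^bsub>M\<^esub> (a \<odot>\<^bsub>M\<^esub> h) = H +>\<^bsub>M\<^esub> \<zero>\<^bsub>M\<^esub>"
      using submodule.smult_closed[OF H assms(2) h(1)] H.a_rcos_const H.a_subset by simp
    finally show ?thesis
      using assms by (simp add: H.a_rcos_sum)
  qed
  have "(\<Union>y\<in>H +>\<^bsub>M\<^esub> x. H +>\<^bsub>M\<^esub> (a \<odot>\<^bsub>M\<^esub> y)) = H +>\<^bsub>M\<^esub> (a \<odot>\<^bsub>M\<^esub> x)"
    by (rule UN_constant_eq[OF H.a_rcos_self[OF assms(3)]]) (intro ballI coset)
  then show ?thesis
    by (simp only: quot_module_def module.simps)
qed

lemma quot_module_add:
  assumes "submodule H R M" "x \<in> carrier M" "y \<in> carrier M"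
  shows "(H +>\<^bsub>M\<^esub> x) \<oplus>\<^bsub>quot_module M H\<^esub> (H +>\<^bsub>M\<^esub> y) = H +>\<^bsub>M\<^esub> (x \<oplus>\<^bsub>M\<^esub> y)"
  using abelian_subgroup.a_rcos_sum[OF abelian_subgroup_submodule[OF assms(1)]] assms
  by (simp add: quot_module_def)

lemma quot_module_carrier: "carrier (quot_module M H) = (\<lambda>x. H +>\<^bsub>M\<^esub> x) ` carrier M"
  by (auto simp: quot_module_def A_RCOSETS_def')

lemma quot_module_zero:
  assumes "submodule H R M"
  shows "\<zero>\<^bsub>quot_module M H\<^esub> = H +>\<^bsub>M\<^esub> \<zero>\<^bsub>M\<^esub>"
  using abelian_subgroup.a_rcos_const[OF abelian_subgroup_submodule[OF assms], of "\<zero>\<^bsub>M\<^esub>"]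
    additive_subgroup.zero_closed[OF abelian_subgroup.axioms(1)[OF abelian_subgroup_submodule[OF assms]]]
  by (simp add: quot_module_def)

lemma quot_module_eq_zero_iff:
  assumes H: "submodule H R M" and x: "x \<in> carrier M"
  shows "H +>\<^bsub>M\<^esub> x = \<zero>\<^bsub>quot_module M H\<^esub> \<longleftrightarrow> x \<in> H"
  using abelian_subgroup.a_rcos_const[OF abelian_subgroup_submodule[OF H], of x]
    abelian_subgroup.a_rcos_self[OF abelian_subgroup_submodule[OF H] x]
  by (auto simp: quot_module_def)

lemma module_quot_module:
  assumes H: "submodule H R M"
  shows "Module.module R (quot_module M H)"
proof (rule moduleI)
  show "cring R"
    by (rule R.cring_axioms)
  show "abelian_group (quot_module M H)"
  proof (rule abelian_groupI)
    fix x assume "x \<in> carrier (quot_module M H)"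
    then obtain u where u: "x = H +>\<^bsub>M\<^esub> u" "u \<in> carrier M"
      by (auto simp: quot_module_carrier)
    then show "\<exists>y\<in>carrier (quot_module M H). y \<oplus>\<^bsub>quot_module M H\<^esub> x = \<zero>\<^bsub>quot_module M H\<^esub>"
      using H by (intro bexI[of _ "H +>\<^bsub>M\<^esub> (\<ominus>\<^bsub>M\<^esub> u)"])
        (auto simp: quot_module_carrier quot_module_add quot_module_zero M.l_neg)
    fix y z assume "y \<in> carrier (quot_module M H)" "z \<in> carrier (quot_module M H)"
    then show "x \<oplus>\<^bsub>quot_module M H\<^esub> y \<oplus>\<^bsub>quot_module M H\<^esub> z =
        x \<oplus>\<^bsub>quot_module M H\<^esub> (y \<oplus>\<^bsub>quot_module M H\<^esub> z)"
      using H u by (auto simp: quot_module_carrier quot_module_add M.a_assoc)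
  qed (use H in \<open>auto simp: quot_module_carrier quot_module_add quot_module_zero M.a_comm\<close>)
qed (use H in \<open>auto simp: quot_module_carrier quot_module_add quot_module_smult
  smult_l_distr smult_r_distr smult_assoc1\<close>)

end

section \<open>The quotient by a monic polynomial\<close>

locale monic_quotient = subring_set S for S :: "'a::idom set" +
  fixes P :: "'a poly"
  assumes monic: "lead_coeff P = 1" and P_mem: "P \<in> poly_over S"
begin

sublocale X: subring_set "poly_over S"
  by (rule subring_set_poly_over)

abbreviation N :: "('a, 'a poly set) module" where "N \<equiv> poly_quot S P"

lemma cring_poly_over: "cring (subset_ring (poly_over S))"
  by (rule X.cring_subset_ring)

lemma ideal_poly_ideal: "ideal (poly_ideal S P) (subset_ring (poly_over S))"
  unfolding poly_ideal_def using P_mem by (intro cring.cgenideal_ideal[OF cring_poly_over]) simp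

text \<open>The ideal is formed over \<open>S\<close> but divisibility is ambient; they agree
  because the quotient by a monic P stays over \<open>S\<close>. Equality of classes thus becomes a
  divisibility statement.\<close>

lemma poly_ideal_iff: "f \<in> poly_ideal S P \<longleftrightarrow> f \<in> poly_over S \<and> P dvd f"
proof
  assume "f \<in> poly_ideal S P"
  then show "f \<in> poly_over S \<and> P dvd f"
    using P_mem by (auto simp: poly_ideal_def X.PIdl_subset_ring X.mult_mem)
next
  assume f: "f \<in> poly_over S \<and> P dvd f"
  then obtain q where "f = q * P"
    by (metis dvdE mult.commute)
  then show "f \<in> poly_ideal S P"
    using f quotient_mem_poly_over[OF monic P_mem] by (auto simp: poly_ideal_def X.PIdl_subset_ring)
qed

lemma poly_class_eq_iff:
  assumes f: "f \<in> poly_over S" and g: "g \<in> poly_over S"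
  shows "poly_class S P f = poly_class S P g \<longleftrightarrow> P dvd f - g"
proof -
  interpret Q: cring "subset_ring (poly_over S)"
    by (rule cring_poly_over)
  have "\<ominus>\<^bsub>subset_ring (poly_over S)\<^esub> g = - g"
    using g by (intro Q.minus_equality) (auto intro: X.uminus_mem)
  then have "f \<ominus>\<^bsub>subset_ring (poly_over S)\<^esub> g = f - g"
    by (simp add: a_minus_def)
  then show ?thesis
    using Q.quotient_eq_iff_same_a_r_cos[OF ideal_poly_ideal, of f g] f g
    by (auto simp: poly_class_def poly_ideal_iff X.diff_mem)
qed

lemma poly_quot_carrier: "carrier N = poly_class S P ` poly_over S"
  by (auto simp: poly_quot_def FactRing_def A_RCOSETS_def' poly_class_def)

lemma poly_quot_add:
  assumes "f \<in> poly_over S" "g \<in> poly_over S"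
  shows "poly_class S P f \<oplus>\<^bsub>N\<^esub> poly_class S P g = poly_class S P (f + g)"
  using ideal.a_rcos_sum[OF ideal_poly_ideal, of f g] assms
  by (simp add: poly_quot_def FactRing_def poly_class_def)

lemma poly_quot_mult:
  assumes "f \<in> poly_over S" "g \<in> poly_over S"
  shows "poly_class S P f \<otimes>\<^bsub>N\<^esub> poly_class S P g = poly_class S P (f * g)"
  using ideal.rcoset_mult_add[OF ideal_poly_ideal, of f g] assms
  by (simp add: poly_quot_def FactRing_def poly_class_def)

lemma poly_quot_smult:
  assumes "a \<in> S" "f \<in> poly_over S"
  shows "a \<odot>\<^bsub>N\<^esub> poly_class S P f = poly_class S P ([:a:] * f)"
proof -
  have "a \<odot>\<^bsub>N\<^esub> poly_class S P f = poly_class S P [:a:] \<otimes>\<^bsub>N\<^esub> poly_class S P f"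
    by (simp add: poly_quot_def Let_def)
  then show ?thesis
    using poly_quot_mult[of "[:a:]" f] assms const_mem_poly_over[of a] by simp
qed

lemma poly_quot_zero: "\<zero>\<^bsub>N\<^esub> = poly_class S P 0"
proof -
  interpret Q: cring "subset_ring (poly_over S)"
    by (rule cring_poly_over)
  show ?thesis
    using Q.a_rcos_zero[OF ideal_poly_ideal, of 0]
    by (simp add: poly_quot_def FactRing_def poly_class_def poly_ideal_iff)
qed

lemma module_poly_quot: "Module.module (subset_ring S) N"
proof (rule moduleI)
  show "cring (subset_ring S)"
    by (rule cring_subset_ring)
  show "abelian_group N"
  proof (rule abelian_groupI)
    fix x assume "x \<in> carrier N"
    then obtain f where f: "x = poly_class S P f" "f \<in> poly_over S"
      by (auto simp: poly_quot_carrier)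
    then show "\<exists>y\<in>carrier N. y \<oplus>\<^bsub>N\<^esub> x = \<zero>\<^bsub>N\<^esub>"
      by (intro bexI[of _ "poly_class S P (- f)"])
        (auto simp: poly_quot_carrier poly_quot_add poly_quot_zero X.uminus_mem)
    fix y z assume "y \<in> carrier N" "z \<in> carrier N"
    then show "x \<oplus>\<^bsub>N\<^esub> y \<oplus>\<^bsub>N\<^esub> z = x \<oplus>\<^bsub>N\<^esub> (y \<oplus>\<^bsub>N\<^esub> z)"
      using f by (auto simp: poly_quot_carrier poly_quot_add X.add_mem add.assoc)
  qed (auto simp: poly_quot_carrier poly_quot_add poly_quot_zero X.add_mem add.commute)
  show "\<one>\<^bsub>subset_ring S\<^esub> \<odot>\<^bsub>N\<^esub> x = x" if "x \<in> carrier N" for x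
    using that by (auto simp: poly_quot_carrier poly_quot_smult)
  fix a b x y
  assume a: "a \<in> carrier (subset_ring S)" and b: "b \<in> carrier (subset_ring S)"
    and x: "x \<in> carrier N" and y: "y \<in> carrier N"
  obtain f g where f: "x = poly_class S P f" "f \<in> poly_over S"
    and g: "y = poly_class S P g" "g \<in> poly_over S"
    using x y by (auto simp: poly_quot_carrier)
  have ab: "[:a:] \<in> poly_over S" "[:b:] \<in> poly_over S" "a \<in> S" "b \<in> S"
    using a b by (simp_all add: const_mem_poly_over)
  have af: "[:a:] * f \<in> poly_over S" "[:b:] * f \<in> poly_over S" "[:a:] * g \<in> poly_over S"
    using ab f g X.mult_mem by blast+
  show "a \<odot>\<^bsub>N\<^esub> x \<in> carrier N"
    using ab f af by (simp only: poly_quot_carrier poly_quot_smult) simp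
  have "(a \<oplus>\<^bsub>subset_ring S\<^esub> b) \<odot>\<^bsub>N\<^esub> x = poly_class S P ([:a + b:] * f)"
    using ab f by (simp only: poly_quot_smult add_mem subset_ring_simps)
  also have "[:a + b:] * f = [:a:] * f + [:b:] * f"
    by (simp add: smult_add_left)
  finally show "(a \<oplus>\<^bsub>subset_ring S\<^esub> b) \<odot>\<^bsub>N\<^esub> x = a \<odot>\<^bsub>N\<^esub> x \<oplus>\<^bsub>N\<^esub> b \<odot>\<^bsub>N\<^esub> x"
    using ab f af by (simp only: poly_quot_smult poly_quot_add)
  show "a \<odot>\<^bsub>N\<^esub> (x \<oplus>\<^bsub>N\<^esub> y) = a \<odot>\<^bsub>N\<^esub> x \<oplus>\<^bsub>N\<^esub> a \<odot>\<^bsub>N\<^esub> y"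
    using ab f g af by (simp only: poly_quot_smult poly_quot_add X.add_mem distrib_left)
  have "(a \<otimes>\<^bsub>subset_ring S\<^esub> b) \<odot>\<^bsub>N\<^esub> x = poly_class S P ([:a * b:] * f)"
    using ab f by (simp only: poly_quot_smult mult_mem subset_ring_simps)
  also have "[:a * b:] * f = [:a:] * ([:b:] * f)"
    by (simp add: mult.commute)
  finally show "(a \<otimes>\<^bsub>subset_ring S\<^esub> b) \<odot>\<^bsub>N\<^esub> x = a \<odot>\<^bsub>N\<^esub> (b \<odot>\<^bsub>N\<^esub> x)"
    using ab f af by (simp only: poly_quot_smult)
qed

end

section \<open>The cokernel of multiplication by a polynomial\<close>

locale monic_quotient_mult = monic_quotient S P for S :: "'a::idom set" and P +
  fixes F :: "'a poly"
  assumes F_mem: "F \<in> poly_over S"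
begin

abbreviation M :: "('a, 'a poly set set) module" where "M \<equiv> coker N N (mult_map S P F)"

sublocale N: Module.module "subset_ring S" "poly_quot S P"
  by (rule module_poly_quot)

lemma mult_map_class: "f \<in> poly_over S \<Longrightarrow> mult_map S P F (poly_class S P f) = poly_class S P (F * f)"
  using F_mem by (simp add: mult_map_def poly_quot_mult)

lemma mult_map_linear: "mult_map S P F \<in> linear_maps (subset_ring S) N N"
proof -
  have "mult_map S P F (a \<odot>\<^bsub>N\<^esub> poly_class S P f) = a \<odot>\<^bsub>N\<^esub> mult_map S P F (poly_class S P f)"
    if "a \<in> S" "f \<in> poly_over S" for a f
  proof -
    have "[:a:] * f \<in> poly_over S" "F * f \<in> poly_over S"
      using that const_mem_poly_over F_mem X.mult_mem by blast+
    then show ?thesis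
      using that mult.left_commute[of F "[:a:]" f] by (simp only: mult_map_class poly_quot_smult)
  qed
  then show ?thesis
    using F_mem by (auto simp: linear_maps_def poly_quot_carrier mult_map_class poly_quot_add
        X.mult_mem X.add_mem distrib_left)
qed

definition H :: "'a poly set set" where "H = mult_map S P F ` carrier N"

lemma H_eq: "H = (\<lambda>g. poly_class S P (F * g)) ` poly_over S"
  by (auto simp: H_def poly_quot_carrier mult_map_class image_image)

lemma submodule_H: "submodule H (subset_ring S) N"
proof (rule N.submoduleI)
  have mem: "F * g \<in> poly_over S" if "g \<in> poly_over S" for g
    using that F_mem X.mult_mem by blast
  show "H \<subseteq> carrier N"
    using mem by (auto simp: H_eq poly_quot_carrier)
  show "\<zero>\<^bsub>N\<^esub> \<in> H"
    unfolding H_eq by (rule image_eqI[of _ _ 0]) (simp_all add: poly_quot_zero)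
  show "a \<oplus>\<^bsub>N\<^esub> b \<in> H" if ab: "a \<in> H" "b \<in> H" for a b
  proof -
    obtain f g where "a = poly_class S P (F * f)" "b = poly_class S P (F * g)" "f \<in> poly_over S" "g \<in> poly_over S"
      using ab by (auto simp: H_eq)
    then show ?thesis
      unfolding H_eq by (intro image_eqI[of _ _ "f + g"]) (simp_all add: mem poly_quot_add X.add_mem distrib_left)
  qed
  show smult: "c \<odot>\<^bsub>N\<^esub> a \<in> H" if ca: "c \<in> carrier (subset_ring S)" "a \<in> H" for c a
  proof -
    obtain f where f: "a = poly_class S P (F * f)" "f \<in> poly_over S"
      using ca by (auto simp: H_eq)
    have cf: "[:c:] * f \<in> poly_over S"
      using ca f const_mem_poly_over by (intro X.mult_mem) simp_all
    have "c \<odot>\<^bsub>N\<^esub> a = poly_class S P ([:c:] * (F * f))"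
      unfolding f(1) using ca mem[OF f(2)] by (intro poly_quot_smult) simp_all
    also have "[:c:] * (F * f) = F * ([:c:] * f)"
      by (simp only: mult.left_commute)
    finally show ?thesis
      unfolding H_eq using cf by (rule image_eqI)
  qed
  show "\<ominus>\<^bsub>N\<^esub> a \<in> H" if a: "a \<in> H" for a
  proof -
    obtain f where f: "a = poly_class S P (F * f)" "f \<in> poly_over S"
      using a by (auto simp: H_eq)
    have "\<ominus>\<^bsub>N\<^esub> a = poly_class S P (F * - f)"
      using f mem X.uminus_mem
      by (intro N.M.minus_equality) (auto simp: poly_quot_add poly_quot_zero poly_quot_carrier)
    then show ?thesis
      using f X.uminus_mem unfolding H_eq by (intro image_eqI[of _ _ "- f"]) auto
  qed
qed

lemma M_eq: "M = quot_module N H"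
  by (simp add: coker_def H_def)

lemma module_M: "Module.module (subset_ring S) M"
  unfolding M_eq by (rule N.module_quot_module[OF submodule_H])

sublocale M: subset_module S "coker (poly_quot S P) (poly_quot S P) (mult_map S P F)"
  by (intro subset_module.intro subring_set_axioms module_M)

definition proj :: "'a poly \<Rightarrow> 'a poly set set" where
  "proj f = H +>\<^bsub>N\<^esub> poly_class S P f"

lemma proj_closed: "f \<in> poly_over S \<Longrightarrow> proj f \<in> carrier M"
  by (simp add: M_eq proj_def N.quot_module_carrier poly_quot_carrier)

lemma proj_surj: "y \<in> carrier M \<Longrightarrow> \<exists>f\<in>poly_over S. y = proj f"
  by (auto simp: M_eq proj_def N.quot_module_carrier poly_quot_carrier)

lemma proj_add: "f \<in> poly_over S \<Longrightarrow> g \<in> poly_over S \<Longrightarrow> proj (f + g) = proj f \<oplus>\<^bsub>M\<^esub> proj g"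
  by (simp add: M_eq proj_def N.quot_module_add[OF submodule_H] poly_quot_carrier poly_quot_add)

lemma proj_smult: "a \<in> S \<Longrightarrow> f \<in> poly_over S \<Longrightarrow> proj ([:a:] * f) = a \<odot>\<^bsub>M\<^esub> proj f"
  by (simp add: M_eq proj_def N.quot_module_smult[OF submodule_H] poly_quot_carrier poly_quot_smult
      del: mult_pCons_left mult_pCons_right)

text \<open>The cokernel is the polynomial ring over \<open>S\<close> modulo P and F, so vanishing
  means membership in the ideal generated by both.\<close>

lemma proj_eq_0_iff:
  assumes f: "f \<in> poly_over S"
  shows "proj f = \<zero>\<^bsub>M\<^esub> \<longleftrightarrow> (\<exists>g\<in>poly_over S. P dvd f - F * g)"
proof -
  have "proj f = \<zero>\<^bsub>M\<^esub> \<longleftrightarrow> poly_class S P f \<in> H"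
    unfolding M_eq proj_def using f
    by (intro N.quot_module_eq_zero_iff[OF submodule_H]) (simp add: poly_quot_carrier)
  also have "\<dots> \<longleftrightarrow> (\<exists>g\<in>poly_over S. poly_class S P f = poly_class S P (F * g))"
    by (auto simp: H_eq)
  also have "\<dots> \<longleftrightarrow> (\<exists>g\<in>poly_over S. P dvd f - F * g)"
    using f F_mem by (intro bex_cong refl poly_class_eq_iff X.mult_mem)
  finally show ?thesis .
qed

lemma proj_sum:
  fixes n :: nat
  assumes "\<And>j. j < n \<Longrightarrow> b j \<in> S"
  shows "proj (\<Sum>j<n. Polynomial.monom (b j) j) =
    (\<Oplus>\<^bsub>M\<^esub>j\<in>{..<n}. b j \<odot>\<^bsub>M\<^esub> proj (Polynomial.monom 1 j))"
  using assms
proof (induct n)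
  case 0
  have "proj 0 = \<zero>\<^bsub>M\<^esub>"
    by (subst proj_eq_0_iff) (auto intro!: bexI[of _ 0])
  then show ?case
    by simp
next
  case (Suc n)
  have mon: "proj (Polynomial.monom 1 j) \<in> carrier M" for j
    by (intro proj_closed monom_mem_poly_over) simp
  have "proj (\<Sum>j<Suc n. Polynomial.monom (b j) j) =
      proj (\<Sum>j<n. Polynomial.monom (b j) j) \<oplus>\<^bsub>M\<^esub> proj (Polynomial.monom (b n) n)"
    using Suc(2) unfolding sum.lessThan_Suc by (intro proj_add X.sum_mem monom_mem_poly_over) simp_all
  also have "proj (Polynomial.monom (b n) n) = b n \<odot>\<^bsub>M\<^esub> proj (Polynomial.monom 1 n)"
    using proj_smult[of "b n" "Polynomial.monom 1 n"] Suc(2) by (simp add: smult_monom monom_mem_poly_over)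
  also have "proj (\<Sum>j<n. Polynomial.monom (b j) j) =
      (\<Oplus>\<^bsub>M\<^esub>j\<in>{..<n}. b j \<odot>\<^bsub>M\<^esub> proj (Polynomial.monom 1 j))"
    using Suc by simp
  also have "\<dots> \<oplus>\<^bsub>M\<^esub> b n \<odot>\<^bsub>M\<^esub> proj (Polynomial.monom 1 n) =
      (\<Oplus>\<^bsub>M\<^esub>j\<in>{..<Suc n}. b j \<odot>\<^bsub>M\<^esub> proj (Polynomial.monom 1 j))"
  proof -
    have *: "b j \<odot>\<^bsub>M\<^esub> proj (Polynomial.monom 1 j) \<in> carrier M" if "j < Suc n" for j
      using M.smult_closed[simplified, OF Suc(2)[OF that] mon] .
    then show ?thesis
      unfolding lessThan_Suc by (subst M.M.finsum_insert) (auto intro!: M.M.add.m_comm M.M.finsum_closed)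
  qed
  finally show ?case .
qed

section \<open>Relations among the classes of the powers of the variable\<close>

abbreviation basis :: "nat \<Rightarrow> 'a poly set set" where "basis j \<equiv> proj (Polynomial.monom 1 j)"

lemma remainder:
  assumes "f \<in> poly_over S"
  obtains c where "\<And>j. c j \<in> S" "P dvd f - (\<Sum>j<Polynomial.degree P. Polynomial.monom (c j) j)"
proof -
  obtain q r where r: "r \<in> poly_over S" "f = q * P + r"
    "\<And>i. i \<ge> Polynomial.degree P \<Longrightarrow> Polynomial.coeff r i = 0"
    using monic_division[OF monic P_mem assms] by blast
  have "(\<Sum>j<Polynomial.degree P. Polynomial.monom (Polynomial.coeff r j) j) = r"
    by (rule poly_eqI) (use r(3) in \<open>auto simp: coeff_sum_monom\<close>)
  then show ?thesis
    using r by (intro that[of "Polynomial.coeff r"]) (auto simp: poly_over_def)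
qed

lemma generates_basis: "generates (subset_ring S) M (Polynomial.degree P) basis"
  unfolding generates_def
proof (intro conjI ballI)
  show "basis \<in> {..<Polynomial.degree P} \<rightarrow> carrier M"
    by (intro funcsetI proj_closed monom_mem_poly_over) simp
  fix y assume "y \<in> carrier M"
  then obtain f where f: "f \<in> poly_over S" "y = proj f"
    using proj_surj by blast
  obtain c where c: "\<And>j. c j \<in> S" "P dvd f - (\<Sum>j<Polynomial.degree P. Polynomial.monom (c j) j)"
    using remainder[OF f(1)] by blast
  have "(\<Sum>j<Polynomial.degree P. Polynomial.monom (c j) j) \<in> poly_over S"
    using c(1) by (intro X.sum_mem monom_mem_poly_over)
  then have "proj f = proj (\<Sum>j<Polynomial.degree P. Polynomial.monom (c j) j)"
    using c(2) f(1) unfolding proj_def by (subst poly_class_eq_iff[THEN iffD2]) auto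
  then show "\<exists>a\<in>{..<Polynomial.degree P} \<rightarrow> carrier (subset_ring S).
      y = (\<Oplus>\<^bsub>M\<^esub>i\<in>{..<Polynomial.degree P}. a i \<odot>\<^bsub>M\<^esub> basis i)"
    using c(1) f(2) proj_sum[of "Polynomial.degree P" c] by (intro bexI[of _ c]) auto
qed

lemma relation_matrix_iff:
  "B \<in> relation_matrices S M (Polynomial.degree P) basis \<longleftrightarrow>
    B \<in> carrier_mat (Polynomial.degree P) (Polynomial.degree P) \<and>
    (\<forall>i<Polynomial.degree P. \<forall>j<Polynomial.degree P. B $$ (i, j) \<in> S) \<and>
    (\<forall>i<Polynomial.degree P. \<exists>g\<in>poly_over S.
      P dvd (\<Sum>j<Polynomial.degree P. Polynomial.monom (B $$ (i, j)) j) - F * g)"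
proof -
  have "(\<Oplus>\<^bsub>M\<^esub>j\<in>{..<Polynomial.degree P}. B $$ (i, j) \<odot>\<^bsub>M\<^esub> basis j) = \<zero>\<^bsub>M\<^esub> \<longleftrightarrow>
      (\<exists>g\<in>poly_over S. P dvd (\<Sum>j<Polynomial.degree P. Polynomial.monom (B $$ (i, j)) j) - F * g)"
    if "\<forall>i<Polynomial.degree P. \<forall>j<Polynomial.degree P. B $$ (i, j) \<in> S" "i < Polynomial.degree P" for i
  proof -
    have f: "(\<Sum>j<Polynomial.degree P. Polynomial.monom (B $$ (i, j)) j) \<in> poly_over S"
      using that by (intro X.sum_mem monom_mem_poly_over) simp
    show ?thesis
      using that proj_eq_0_iff[OF f] proj_sum[of "Polynomial.degree P" "\<lambda>j. B $$ (i, j)"] by simp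
  qed
  then show ?thesis
    unfolding relation_matrices_def mem_Collect_eq by (intro conj_cong refl) simp
qed

lemma mult_matrix_relation:
  assumes A: "is_mult_matrix P F A"
    and AS: "\<And>i j. i < Polynomial.degree P \<Longrightarrow> j < Polynomial.degree P \<Longrightarrow> A $$ (i, j) \<in> S"
  shows "A \<in> relation_matrices S M (Polynomial.degree P) basis"
  unfolding relation_matrix_iff
proof (intro conjI allI impI)
  fix i assume "i < Polynomial.degree P"
  then have "P dvd Polynomial.monom 1 i * F - (\<Sum>j<Polynomial.degree P. Polynomial.monom (A $$ (i, j)) j)"
    by (rule is_mult_matrixD[OF A])
  then have "P dvd - (Polynomial.monom 1 i * F - (\<Sum>j<Polynomial.degree P. Polynomial.monom (A $$ (i, j)) j))"
    by (simp only: dvd_minus_iff)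
  \<comment> \<open>Row i is a relation because it represents F times the i-th power; that power is
    the witness \<open>g\<close>.\<close>
  then have "P dvd (\<Sum>j<Polynomial.degree P. Polynomial.monom (A $$ (i, j)) j) - F * Polynomial.monom 1 i"
    by (simp only: minus_diff_eq mult.commute)
  then show "\<exists>g\<in>poly_over S. P dvd (\<Sum>j<Polynomial.degree P. Polynomial.monom (A $$ (i, j)) j) - F * g"
    using monom_mem_poly_over[of 1 i] by auto
qed (use A AS in \<open>auto simp: is_mult_matrix_def\<close>)

text \<open>Each row of \<open>B\<close> represents some F g modulo P. The coordinates of g modulo P
  form the corresponding row of \<open>D\<close>, since F g is then the same combination of the rows
  of \<open>A\<close>.\<close>

lemma relation_matrix_factor:
  assumes A: "is_mult_matrix P F A"
    and B: "B \<in> relation_matrices S M (Polynomial.degree P) basis"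
  obtains D where "D \<in> carrier_mat (Polynomial.degree P) (Polynomial.degree P)"
    "\<And>i j. i < Polynomial.degree P \<Longrightarrow> j < Polynomial.degree P \<Longrightarrow> D $$ (i, j) \<in> S" "B = D * A"
proof -
  let ?n = "Polynomial.degree P"
  let ?Q = "\<lambda>i c. i < ?n \<longrightarrow> (\<forall>j. c j \<in> S) \<and>
      P dvd (\<Sum>j<?n. Polynomial.monom (B $$ (i, j)) j) - F * (\<Sum>k<?n. Polynomial.monom (c k) k)"
  have "\<exists>c. ?Q i c" for i
  proof (cases "i < ?n")
    case True
    then obtain g where g: "g \<in> poly_over S" "P dvd (\<Sum>j<?n. Polynomial.monom (B $$ (i, j)) j) - F * g"
      using B unfolding relation_matrix_iff by blast
    obtain c where c: "\<And>j. c j \<in> S" "P dvd g - (\<Sum>k<?n. Polynomial.monom (c k) k)"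
      using remainder[OF g(1)] by blast
    \<comment> \<open>Replacing g by its remainder changes F g only by a multiple of P.\<close>
    have "P dvd ((\<Sum>j<?n. Polynomial.monom (B $$ (i, j)) j) - F * g) + F * (g - (\<Sum>k<?n. Polynomial.monom (c k) k))"
      using g(2) c(2) by (intro dvd_add dvd_mult)
    then show ?thesis
      using c(1) by (intro exI[of _ c]) (simp add: right_diff_distrib)
  qed simp
  then have "\<forall>i. \<exists>c. ?Q i c"
    by (rule allI)
  then have "\<exists>c. \<forall>i. ?Q i (c i)"
    by (rule choice)
  then obtain c where "\<forall>i. ?Q i (c i)"
    by (rule exE)
  then have c: "\<And>i j. i < ?n \<Longrightarrow> c i j \<in> S"
    "\<And>i. i < ?n \<Longrightarrow> P dvd (\<Sum>j<?n. Polynomial.monom (B $$ (i, j)) j) - F * (\<Sum>k<?n. Polynomial.monom (c i k) k)"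
    by simp_all
  define D where "D = mat ?n ?n (\<lambda>(i, j). c i j)"
  have Ac: "A \<in> carrier_mat ?n ?n" and Bc: "B \<in> carrier_mat ?n ?n"
    using A B by (auto simp: is_mult_matrix_def relation_matrices_def)
  have "B = D * A"
  proof (rule eq_matI)
    fix i j assume "i < dim_row (D * A)" "j < dim_col (D * A)"
    then have i: "i < ?n" and j: "j < ?n"
      using Ac by (simp_all add: D_def)
    define a where "a k = (\<Sum>j<?n. Polynomial.monom (A $$ (k, j)) j)" for k
    define b where "b = (\<Sum>j<?n. Polynomial.monom (B $$ (i, j)) j)"
    have "F * (\<Sum>k<?n. Polynomial.monom (c i k) k) - (\<Sum>k<?n. [:c i k:] * a k) =
        (\<Sum>k<?n. F * Polynomial.monom (c i k) k - [:c i k:] * a k)"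
      by (simp only: sum_distrib_left sum_subtractf)
    also have "\<dots> = (\<Sum>k<?n. [:c i k:] * (Polynomial.monom 1 k * F - a k))"
    proof (rule sum.cong)
      fix k
      have "Polynomial.monom (c i k) k = [:c i k:] * Polynomial.monom 1 k"
        by (simp add: smult_monom)
      then show "F * Polynomial.monom (c i k) k - [:c i k:] * a k = [:c i k:] * (Polynomial.monom 1 k * F - a k)"
        by (simp only: right_diff_distrib mult.assoc mult.commute mult.left_commute)
    qed simp
    finally have "P dvd F * (\<Sum>k<?n. Polynomial.monom (c i k) k) - (\<Sum>k<?n. [:c i k:] * a k)"
      using is_mult_matrixD[OF A] unfolding a_def by (simp only:) (intro dvd_sum dvd_mult, simp)
    then have "P dvd (b - F * (\<Sum>k<?n. Polynomial.monom (c i k) k)) +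
        (F * (\<Sum>k<?n. Polynomial.monom (c i k) k) - (\<Sum>k<?n. [:c i k:] * a k))"
      using c(2)[OF i] unfolding b_def by (intro dvd_add)
    then have "P dvd b - (\<Sum>k<?n. [:c i k:] * a k)"
      by simp
    \<comment> \<open>Both sides of the congruence have degree below that of P, so it is an equality
      and may be compared coefficient by coefficient.\<close>
    moreover have coeff: "Polynomial.coeff (b - (\<Sum>k<?n. [:c i k:] * a k)) l =
        (if l < ?n then B $$ (i, l) - (\<Sum>k<?n. c i k * A $$ (k, l)) else 0)" for l
      by (simp add: a_def b_def coeff_sum coeff_sum_monom)
    ultimately have "b - (\<Sum>k<?n. [:c i k:] * a k) = 0"
      by (intro dvd_low_degree_eq_0[of P]) auto
    then have "B $$ (i, j) = (\<Sum>k<?n. c i k * A $$ (k, j))"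
      using coeff[of j] j by simp
    then show "B $$ (i, j) = (D * A) $$ (i, j)"
      using Ac i j by (simp add: D_def scalar_prod_def lessThan_atLeast0)
  qed (use Ac Bc in \<open>auto simp: D_def\<close>)
  then show ?thesis
    using c(1) by (intro that[of D]) (auto simp: D_def)
qed

lemma fitting_ideal_basis:
  assumes A: "is_mult_matrix P F A"
    and AS: "\<And>i j. i < Polynomial.degree P \<Longrightarrow> j < Polynomial.degree P \<Longrightarrow> A $$ (i, j) \<in> S"
  shows "fitting0 S M = PIdl\<^bsub>subset_ring S\<^esub> (Determinant.det A)"
proof -
  let ?D = "Determinant.det ` relation_matrices S M (Polynomial.degree P) basis"
  have A_rel: "A \<in> relation_matrices S M (Polynomial.degree P) basis"
    using A AS by (rule mult_matrix_relation)
  have sub: "?D \<subseteq> S"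
    by (auto simp: relation_matrices_def intro: det_mem)
  have "Idl\<^bsub>subset_ring S\<^esub> ?D = PIdl\<^bsub>subset_ring S\<^esub> (Determinant.det A)"
  proof
    have "Determinant.det B \<in> PIdl\<^bsub>subset_ring S\<^esub> (Determinant.det A)"
      if B: "B \<in> relation_matrices S M (Polynomial.degree P) basis" for B
    proof -
      obtain D where D: "D \<in> carrier_mat (Polynomial.degree P) (Polynomial.degree P)"
        "\<And>i j. i < Polynomial.degree P \<Longrightarrow> j < Polynomial.degree P \<Longrightarrow> D $$ (i, j) \<in> S" "B = D * A"
        using relation_matrix_factor[OF A B] by metis
      have "Determinant.det B = Determinant.det D * Determinant.det A"
        using D A by (auto simp: is_mult_matrix_def intro: det_mult)
      then show ?thesis
        using det_mem[OF D(1,2)] by (auto simp: PIdl_subset_ring)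
    qed
    then show "Idl\<^bsub>subset_ring S\<^esub> ?D \<subseteq> PIdl\<^bsub>subset_ring S\<^esub> (Determinant.det A)"
      using A_rel sub by (intro N.R.genideal_minimal N.R.cgenideal_ideal) auto
    show "PIdl\<^bsub>subset_ring S\<^esub> (Determinant.det A) \<subseteq> Idl\<^bsub>subset_ring S\<^esub> ?D"
      using A_rel N.R.genideal_self[simplified, OF sub] N.R.genideal_ideal[simplified, OF sub]
      by (intro N.R.cgenideal_minimal) auto
  qed
  then show ?thesis
    using M.fitting0_eq[OF generates_basis] by simp
qed

end

theorem (in monic_quotient_mult) fitting0_coker_mult_map:
  assumes F: "lead_coeff F = 1"
  shows "monic_resultant F P \<in> S"
    and "fitting0 S M = PIdl\<^bsub>subset_ring S\<^esub> (monic_resultant F P)"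
    and "finitely_generated (subset_ring S) M"
    and "monic_resultant F P \<noteq> 0 \<Longrightarrow> torsion_module (subset_ring S) M"
proof -
  obtain A where A: "is_mult_matrix P F A"
    and AS: "\<And>i j. i < Polynomial.degree P \<Longrightarrow> j < Polynomial.degree P \<Longrightarrow> A $$ (i, j) \<in> S"
    using ex_mult_matrix[OF monic P_mem F_mem] by metis
  define u where "u = (- 1 :: 'a) ^ (Polynomial.degree P * Polynomial.degree F)"
  have u: "u \<in> S" "u * u = 1"
    by (simp_all add: u_def flip: power_mult_distrib)
  have res: "monic_resultant F P = u * Determinant.det A"
    unfolding u_def by (rule monic_resultant_eq_det[OF F monic A])
  have det: "Determinant.det A \<in> S"
    using A AS by (auto simp: is_mult_matrix_def intro: det_mem)
  show "monic_resultant F P \<in> S"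
    using res u det mult_mem by simp
  \<comment> \<open>The sign \<open>u\<close> is its own inverse in \<open>S\<close>, so it does not
    change the principal ideal.\<close>
  have "PIdl\<^bsub>subset_ring S\<^esub> (u * Determinant.det A) = PIdl\<^bsub>subset_ring S\<^esub> (Determinant.det A)"
  proof -
    have mem: "x * u \<in> S" if "x \<in> S" for x
      using that u(1) by (rule mult_mem)
    have "x * Determinant.det A = (x * u) * (u * Determinant.det A)" for x
      by (metis u(2) mult.assoc mult.right_neutral)
    then show ?thesis
      unfolding PIdl_subset_ring using mem by (intro subset_antisym subsetI) (blast intro: mult.assoc[symmetric])+
  qed
  then show "fitting0 S M = PIdl\<^bsub>subset_ring S\<^esub> (monic_resultant F P)"
    using fitting_ideal_basis[OF A AS] res by simp
  show "finitely_generated (subset_ring S) M"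
    using generates_basis by (auto simp: finitely_generated_def)
  show "torsion_module (subset_ring S) M" if "monic_resultant F P \<noteq> 0"
    unfolding torsion_module_def
  proof (intro ballI bexI conjI)
    fix y assume y: "y \<in> carrier M"
    \<comment> \<open>A single annihilator serves for all elements: \<open>det A\<close>, which is
      nonzero along with the resultant.\<close>
    show "Determinant.det A \<odot>\<^bsub>M\<^esub> y = \<zero>\<^bsub>M\<^esub>"
      using M.det_relation_matrix_annihilates[OF generates_basis mult_matrix_relation[OF A AS] y] .
    show "Determinant.det A \<noteq> \<zero>\<^bsub>subset_ring S\<^esub>"
      using that res by auto
    show "Determinant.det A \<in> carrier (subset_ring S)"
      using det by simp
  qed
qed

section \<open>The Grover determinant\<close>

text \<open>Only the values at 0 and 1 matter: the leading coefficient stays 1, so the degree cannot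
  drop.\<close>

lemma monic_map_poly:
  assumes "h 0 = 0" "h 1 = (1 :: 'b::idom)" "lead_coeff p = (1 :: 'a::idom)"
  shows "lead_coeff (map_poly h p) = 1"
proof -
  have "Polynomial.coeff (map_poly h p) (Polynomial.degree p) = 1"
    using assms by (simp add: coeff_map_poly)
  moreover have "Polynomial.degree (map_poly h p) = Polynomial.degree p"
    using calculation by (intro antisym degree_map_poly_le le_degree) simp
  ultimately show ?thesis
    by simp
qed

text \<open>In the Leibniz sum the identity contributes a monic term of degree \<open>n * d\<close>.
  Any other permutation moves some index, whose factor has degree below \<open>d\<close>, so its
  term cannot reach the top degree.\<close>

lemma monic_det:
  fixes A :: "'a::idom poly mat"
  assumes A: "A \<in> carrier_mat n n"
    and diag: "\<And>i. i < n \<Longrightarrow> Polynomial.degree (A $$ (i, i)) = d \<and> lead_coeff (A $$ (i, i)) = 1"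
    and off_diag: "\<And>i j. i < n \<Longrightarrow> j < n \<Longrightarrow> i \<noteq> j \<Longrightarrow> Polynomial.degree (A $$ (i, j)) < d"
  shows "lead_coeff (Determinant.det A) = 1"
proof -
  let ?f = "\<lambda>p. signof p * (\<Prod>i = 0..<n. A $$ (i, p i))"
  have nz: "A $$ (i, i) \<noteq> 0" if "i < n" for i
    using diag[OF that] by auto
  have deg: "Polynomial.degree (?f id) = n * d"
    using diag nz by (simp add: degree_prod_eq_sum_degree)
  have "lead_coeff (A $$ (i, i)) = 1" if "i < n" for i
    using diag[OF that] by blast
  then have "lead_coeff (?f id) = 1"
    by (simp add: lead_coeff_prod)
  then have lead: "Polynomial.coeff (?f id) (n * d) = 1"
    using deg by simp
  have "Polynomial.degree (?f p) < n * d" if p: "p \<in> {p. p permutes {0..<n}} - {id}" for p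
  proof -
    have perm: "p permutes {0..<n}" and "p \<noteq> id"
      using p by auto
    obtain k where k: "p k \<noteq> k"
      using \<open>p \<noteq> id\<close> by (auto simp: fun_eq_iff)
    then have kn: "k < n"
      using permutes_not_in[OF perm, of k] by auto
    have pn: "p i < n" if "i < n" for i
      using permutes_in_image[OF perm, of i] that by simp
    have "Polynomial.degree (?f p) = Polynomial.degree (\<Prod>i = 0..<n. A $$ (i, p i))"
      by (cases p rule: sign_cases) simp_all
    also have "\<dots> \<le> (\<Sum>i = 0..<n. Polynomial.degree (A $$ (i, p i)))"
      using degree_prod_sum_le[of "{0..<n}" "\<lambda>i. A $$ (i, p i)"] by (simp add: o_def)
    also have "\<dots> < (\<Sum>i = 0..<n. d)"
    proof (rule sum_strict_mono_ex1)
      show "\<forall>i\<in>{0..<n}. Polynomial.degree (A $$ (i, p i)) \<le> d"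
      proof
        fix i assume "i \<in> {0..<n}"
        then show "Polynomial.degree (A $$ (i, p i)) \<le> d"
          using diag[of i] off_diag[of i "p i"] pn[of i] by (cases "p i = i") auto
      qed
      show "\<exists>i\<in>{0..<n}. Polynomial.degree (A $$ (i, p i)) < d"
        using off_diag[of k "p k"] k kn pn by (intro bexI[of _ k]) auto
    qed simp
    finally show ?thesis
      by simp
  qed
  then have "Polynomial.degree (sum ?f {p. p permutes {0..<n}}) = n * d \<and>
      Polynomial.coeff (sum ?f {p. p permutes {0..<n}}) (n * d) = 1"
    by (intro degree_lcoeff_sum[of ?f id]) (use deg lead in \<open>simp_all add: finite_permutations permutes_id\<close>)
  then show ?thesis
    unfolding det_def'[OF A] by simp
qed

text \<open>With w the entry of the voltage matrix, a diagonal entry is the monic quadratic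
  \<open>[:1, - w, 1:]\<close> and an off-diagonal one is \<open>[:0, - w:]\<close>, of degree at
  most 1.\<close>

lemma monic_grover_poly: "lead_coeff (grover_poly G vs \<alpha>) = 1"
  unfolding grover_poly_def
proof (rule monic_det)
  let ?n = "length vs"
  let ?A = "([:0, 1:] ^ 2 + 1) \<cdot>\<^sub>m 1\<^sub>m ?n - [:0, 1:] \<cdot>\<^sub>m map_mat (\<lambda>c. [:c:]) (voltage_matrix G vs \<alpha>)"
  have W: "voltage_matrix G vs \<alpha> \<in> carrier_mat ?n ?n"
    by (simp add: voltage_matrix_def)
  then show "?A \<in> carrier_mat ?n ?n"
    by (intro carrier_matI) simp_all
  fix i assume i: "i < ?n"
  have "?A $$ (i, i) = [:1, - voltage_matrix G vs \<alpha> $$ (i, i), 1:]"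
    using i W by (simp add: power2_eq_square one_pCons)
  then show "Polynomial.degree (?A $$ (i, i)) = 2 \<and> lead_coeff (?A $$ (i, i)) = 1"
    by simp
  fix j assume j: "j < ?n" "i \<noteq> j"
  have "?A $$ (i, j) = [:0, - voltage_matrix G vs \<alpha> $$ (i, j):]"
    using i j W by simp
  then show "Polynomial.degree (?A $$ (i, j)) < 2"
    by simp
qed

section \<open>Power series over a valuation ring\<close>

text \<open>The ultrametric inequality gives closure under sums. For negation,
  \<open>v (- 1)\<close> is nonnegative with square 1, hence equal to 1.\<close>

lemma subring_set_valuation_ring:
  fixes \<O> :: "'k::field set"
  assumes "is_valuation_ring \<iota> \<O>"
  shows "subring_set \<O>"
proof -
  obtain v where ext: "padic_abs_extension \<iota> v" and \<O>: "\<O> = {x. v x \<le> 1}"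
    using assms unfolding is_valuation_ring_def by (elim exE conjE)
  have v: "0 \<le> v x" "v x = 0 \<longleftrightarrow> x = 0" "v (x * y) = v x * v y" "v (x + y) \<le> max (v x) (v y)" for x y
    using ext by (simp_all add: padic_abs_extension_def)
  have "v 1 = v 1 * v 1" "v 1 \<noteq> 0"
    using v(3)[of 1 1] v(2)[of 1] by simp_all
  then have v1: "v 1 = 1"
    by simp
  have "v (- 1) * v (- 1) = 1"
    using v(3)[of "- 1" "- 1"] v1 by simp
  then have "v (- 1) = 1"
    using v(1)[of "- 1"] by (simp add: square_eq_1_iff)
  then have neg: "v (- x) = v x" for x
    using v(3)[of "- 1" x] by simp
  show ?thesis
  proof
    fix x y assume "x \<in> \<O>" "y \<in> \<O>"
    then show "x + y \<in> \<O>" "x * y \<in> \<O>"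
      using v(4)[of x y] v(1)[of x] v(1)[of y] mult_le_one[of "v x" "v y"] by (auto simp: \<O> v(3))
  qed (use v1 v(2)[of 0] neg in \<open>auto simp: \<O>\<close>)
qed

lemma (in subring_set) subring_set_mfps_over:
  "subring_set (mfps_over S :: ('n::finite, 'a) mfps set)"
  by unfold_locales (auto simp: mfps_over_def zero_mfps.rep_eq one_mfps.rep_eq plus_mfps.rep_eq
      uminus_mfps.rep_eq times_mfps.rep_eq intro: add_mem uminus_mem mult_mem sum_mem)

lemma mfps_const_0: "mfps_const 0 = (0 :: ('n::finite, 'a::comm_ring_1) mfps)"
  by (rule mfps_eqI) (simp add: mfps_const.rep_eq zero_mfps.rep_eq)

lemma mfps_const_1: "mfps_const 1 = (1 :: ('n::finite, 'a::comm_ring_1) mfps)"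
  by (rule mfps_eqI) (simp add: mfps_const.rep_eq one_mfps.rep_eq)

lemma map_mfps_0: "h 0 = 0 \<Longrightarrow> map_mfps h (0 :: ('n::finite, 'a::comm_ring_1) mfps) = (0 :: ('n, 'b::comm_ring_1) mfps)"
  by (rule mfps_eqI) (simp add: map_mfps.rep_eq zero_mfps.rep_eq)

lemma map_mfps_1:
  "h 0 = 0 \<Longrightarrow> h 1 = 1 \<Longrightarrow> map_mfps h (1 :: ('n::finite, 'a::comm_ring_1) mfps) = (1 :: ('n, 'b::comm_ring_1) mfps)"
  by (rule mfps_eqI) (simp add: map_mfps.rep_eq one_mfps.rep_eq)

section \<open>The Fitting ideal for the Grover determinant\<close>

theorem proposition2p2:
  fixes G :: "('v, 'e) pre_digraph"
    and bar :: "'e \<Rightarrow> 'e"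
    and vs :: "'v list"
    and \<alpha> :: "'e \<Rightarrow> 'n::finite \<Rightarrow> 'p::prime_card padic_int"
    and \<iota> :: "'p padic \<Rightarrow> 'k::field"
    and \<O> :: "'k set"
    and P :: "'k poly"
    and \<Lambda> :: "('n, 'k) mfps set"
    and F PA :: "('n, 'k) mfps poly"
    and R :: "('n, 'k) mfps"
    and N :: "(('n, 'k) mfps, ('n, 'k) mfps poly set) module"
    and M :: "(('n, 'k) mfps, ('n, 'k) mfps poly set set) module"
  assumes "fin_digraph G" and "bidirected_digraph G bar"
    and "Digraph_Component.connected G"
    and "\<forall>v\<in>verts G. out_degree G v \<ge> 1"
    and "distinct vs" and "set vs = verts G"
    and "\<forall>e\<in>arcs G. \<alpha> (bar e) = (\<lambda>i. - \<alpha> e i)"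
    and "finite_padic_extension \<iota>" and "is_valuation_ring \<iota> \<O>"
    and "lead_coeff P = 1" and "P \<in> poly_over \<O>"
    and "\<Lambda> = mfps_over \<O>"
    and "PA = map_poly mfps_const P"
    and "F = map_poly (map_mfps \<iota>) (grover_poly G vs \<alpha>)"
    and "F \<in> poly_over \<Lambda>"
    and "R = monic_resultant F PA"
    and "N = poly_quot \<Lambda> PA"
    and "M = coker N N (mult_map \<Lambda> PA F)"
  shows "Module.module (subset_ring \<Lambda>) N
    \<and> mult_map \<Lambda> PA F \<in> linear_maps (subset_ring \<Lambda>) N N
    \<and> Module.module (subset_ring \<Lambda>) M
    \<and> finitely_generated (subset_ring \<Lambda>) M
    \<and> R \<in> \<Lambda>
    \<and> fitting0 \<Lambda> M = PIdl\<^bsub>subset_ring \<Lambda>\<^esub> R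
    \<and> (R \<noteq> 0 \<longrightarrow> finitely_generated (subset_ring \<Lambda>) M \<and> torsion_module (subset_ring \<Lambda>) M)"
proof -
  interpret O: subring_set \<O>
    using assms(9) by (rule subring_set_valuation_ring)
  interpret L: subring_set \<Lambda>
    unfolding assms(12) by (rule O.subring_set_mfps_over)
  have PA: "lead_coeff PA = 1"
    unfolding assms(13) using assms(10) by (intro monic_map_poly mfps_const_0 mfps_const_1)
  have "mfps_const c \<in> \<Lambda>" if "c \<in> \<O>" for c
    using that by (simp add: assms(12) mfps_over_def mfps_const.rep_eq)
  then have PA_mem: "PA \<in> poly_over \<Lambda>"
    using assms(11) by (simp add: assms(13) poly_over_def coeff_map_poly mfps_const_0)
  \<comment> \<open>Additivity forces \<open>\<iota> 0 = 0\<close>. These two values let the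
    coefficientwise image of the Grover determinant stay monic.\<close>
  have \<iota>: "\<iota> 0 = 0" "\<iota> 1 = 1"
    using assms(8) unfolding finite_padic_extension_def by (metis add_cancel_right_right, blast)
  have F: "lead_coeff F = 1"
    unfolding assms(14) using \<iota> monic_grover_poly by (intro monic_map_poly map_mfps_0 map_mfps_1)
  interpret monic_quotient_mult \<Lambda> PA F
    using PA PA_mem assms(15) by unfold_locales
  show ?thesis
    using module_poly_quot mult_map_linear module_M fitting0_coker_mult_map[OF F] assms(16-18) by simp
qed

end
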